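(* Let $m,n\ge 1$ be integers and let $S(m,n)$ be the crease pattern of an $m\times n$ square twist tessellation grid. Then the number of MV-assignments of $S(m,n)$ that locally fold flat is $2^{2mn+m+n}$.
   Context: Square twist tessellation. Fix real numbers $0<a<\ell$. A single square twist is the following crease pattern on the square sheet $[-\ell,\ell]^2$. It has a central square with vertices $(a,0),(0,a),(-a,0),(0,-a)$, whose four sides are creases, and four pleats, each consisting of two parallel creases running from the two endpoints of one side of the central square to the boundary of the sheet: from $(a,0)$ and $(0,a)$ in direction $(1,0)$; from $(0,a)$ and $(-a,0)$ in direction $(0,1)$; from $(-a,0)$ and $(0,-a)$ in direction $(-1,0)$; from $(0,-a)$ and $(a,0)$ in direction $(0,-1)$. Thus each vertex of the central square has degree 4, with angles $90^\circ,45^\circ,90^\circ,135^\circ$ in cyclic order. The crease pattern $S(m,n)$ is obtained by arranging $mn$ such cells in an $m\times n$ grid on a single rectangular sheet, where cells sharing a side are mirror images of each other in the line through that side; the pleats of adjacent twists then line up, and each pleat line running from one twist to an adjacent twist is a single crease. The interior vertices of $S(m,n)$ are the $4mn$ corners of the central squares; all other vertices are endpoints of pleat creases on the boundary of the sheet. MV-assignments. A mountain-valley (MV) assignment of a crease pattern with crease set $E$ is a function $\mu:E\to\{-1,1\}$ ($-1$ is a valley, $1$ is a mountain). It locally folds flat if, for every interior vertex $v$, a small disk around $v$ folds flat without self-intersection along all the creases meeting at $v$ with the mountains and valleys specified by $\mu$. Precisely, let the creases at $v$ divide the disk into sectors. It is required that there is a continuous map $f$ from the disk to the plane that is an isometry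 on each sector, alternately orientation-preserving and orientation-reversing on cyclically consecutive sectors, together with a choice, for any two sectors whose images under $f$ have overlapping interiors, of which one lies above the other (giving a strict total order on the sectors stacked over each point not in the image of a crease), such that: (i) for each crease with adjacent sectors $P$ (orientation-preserving) and $Q$ (orientation-reversing), $Q$ lies above $P$ if $\mu=-1$ on the crease and below $P$ if $\mu=1$; (ii) if the image of a crease between sectors $P,Q$ meets the interior of the image of a sector $R$, then $R$ is not between $P$ and $Q$ in the layer order; (iii) if two creases, between sectors $P,Q$ and between sectors $R,T$ respectively, have the same image and the images of the four sectors lie locally on the same side of it, then it is not the case that exactly one of $R,T$ lies between $P$ and $Q$. *)

theory Defs
  imports "HOL-Analysis.Analysis"
begin

section \<open>The square twist tessellation\<close>

definition twist_corners :: "real \<Rightarrow> complex set" where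
  "twist_corners a = {Complex a 0, Complex 0 a, Complex (- a) 0, Complex 0 (- a)}"

definition twist_sides :: "real \<Rightarrow> complex set set" where
  "twist_sides a =
     {closed_segment (Complex a 0) (Complex 0 a),
      closed_segment (Complex 0 a) (Complex (- a) 0),
      closed_segment (Complex (- a) 0) (Complex 0 (- a)),
      closed_segment (Complex 0 (- a)) (Complex a 0)}"

definition twist_pleats :: "real \<Rightarrow> real \<Rightarrow> complex set set" where
  "twist_pleats a l =
     {closed_segment (Complex a 0) (Complex l 0),
      closed_segment (Complex 0 a) (Complex l a),
      closed_segment (Complex 0 a) (Complex 0 l),
      closed_segment (Complex (- a) 0) (Complex (- a) l),
      closed_segment (Complex (- a) 0) (Complex (- l) 0),
      closed_segment (Complex 0 (- a)) (Complex (- l) (- a)),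
      closed_segment (Complex 0 (- a)) (Complex 0 (- l)),
      closed_segment (Complex a 0) (Complex a (- l))}"

text \<open>
  The cell in row \<open>i\<close> and column \<open>j\<close> is centred at \<open>(2 l j, 2 l i)\<close>. Reflecting a
  horizontally (vertically) adjacent cell in the common side turns \<open>j\<close> into \<open>j + 1\<close>
  (\<open>i\<close> into \<open>i + 1\<close>), which is where the alternating signs come from.
\<close>

definition place_cell :: "real \<Rightarrow> nat \<Rightarrow> nat \<Rightarrow> complex \<Rightarrow> complex" where
  "place_cell l i j z =
     Complex (2 * l * real j + (- 1) ^ j * Re z) (2 * l * real i + (- 1) ^ i * Im z)"

definition grid_sheet :: "real \<Rightarrow> nat \<Rightarrow> nat \<Rightarrow> complex set" where
  "grid_sheet l m n =
     (\<Union>i<m. \<Union>j<n. place_cell l i j ` cbox (Complex (- l) (- l)) (Complex l l))"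

definition grid_vertices :: "real \<Rightarrow> real \<Rightarrow> nat \<Rightarrow> nat \<Rightarrow> complex set" where
  "grid_vertices a l m n = (\<Union>i<m. \<Union>j<n. place_cell l i j ` twist_corners a)"

definition grid_sides :: "real \<Rightarrow> real \<Rightarrow> nat \<Rightarrow> nat \<Rightarrow> complex set set" where
  "grid_sides a l m n = (\<Union>i<m. \<Union>j<n. image (place_cell l i j) ` twist_sides a)"

text \<open>The pleat creases of the individual cells, before adjacent cells are joined.\<close>

definition cell_pleats :: "real \<Rightarrow> real \<Rightarrow> nat \<Rightarrow> nat \<Rightarrow> complex set set" where
  "cell_pleats a l m n = (\<Union>i<m. \<Union>j<n. image (place_cell l i j) ` twist_pleats a l)"

text \<open>
  Two distinct cell pleats that meet away from the corners of the central squares belong to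
  adjacent cells and meet in a point of the common side; together they form a single crease.
  A cell pleat ending on the boundary of the sheet is joined to no other one.
\<close>

definition grid_pleats :: "real \<Rightarrow> real \<Rightarrow> nat \<Rightarrow> nat \<Rightarrow> complex set set" where
  "grid_pleats a l m n =
     {\<Union>{t \<in> cell_pleats a l m n. s \<inter> t - grid_vertices a l m n \<noteq> {}} | s.
        s \<in> cell_pleats a l m n}"

definition grid_creases :: "real \<Rightarrow> real \<Rightarrow> nat \<Rightarrow> nat \<Rightarrow> complex set set" where
  "grid_creases a l m n = grid_sides a l m n \<union> grid_pleats a l m n"


section \<open>Locally flat-foldable mountain-valley assignments\<close>

text \<open>\<open>- 1\<close> is a valley and \<open>1\<close> a mountain.\<close>

definition mv_assignments :: "complex set set \<Rightarrow> (complex set \<Rightarrow> int) set" where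
  "mv_assignments E = E \<rightarrow>\<^sub>E {- 1, 1}"

definition direct_isometry_on :: "complex set \<Rightarrow> (complex \<Rightarrow> complex) \<Rightarrow> bool" where
  "direct_isometry_on S f \<longleftrightarrow> (\<exists>u b. norm u = 1 \<and> (\<forall>z\<in>S. f z = u * z + b))"

definition opposite_isometry_on :: "complex set \<Rightarrow> (complex \<Rightarrow> complex) \<Rightarrow> bool" where
  "opposite_isometry_on S f \<longleftrightarrow> (\<exists>u b. norm u = 1 \<and> (\<forall>z\<in>S. f z = u * cnj z + b))"

text \<open>
  A disk around \<open>v\<close> is small if the crease pattern inside it consists of radii only, one for
  each crease at \<open>v\<close>.
\<close>

definition small_disk ::
  "complex set \<Rightarrow> complex set \<Rightarrow> complex set set \<Rightarrow> complex \<Rightarrow> real \<Rightarrow> bool" where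
  "small_disk X V E v r \<longleftrightarrow>
     0 < r \<and> cball v r \<subseteq> interior X \<and> cball v r \<inter> V = {v} \<and>
     (\<forall>c\<in>E. c \<inter> cball v r \<noteq> {} \<longrightarrow> v \<in> c)"

definition sectors :: "complex set set \<Rightarrow> complex \<Rightarrow> real \<Rightarrow> complex set set" where
  "sectors E v r = closure ` components (ball v r - \<Union>E)"

definition adjacent_sectors ::
  "complex set set \<Rightarrow> complex \<Rightarrow> real \<Rightarrow> complex set \<Rightarrow> complex set \<Rightarrow> complex set \<Rightarrow> bool" where
  "adjacent_sectors E v r c P Q \<longleftrightarrow>
     c \<in> E \<and> v \<in> c \<and> P \<in> sectors E v r \<and> Q \<in> sectors E v r \<and> P \<noteq> Q \<and>
     c \<inter> cball v r \<subseteq> P \<inter> Q"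

text \<open>In a layer order \<open>L\<close>, \<open>(P, Q) \<in> L\<close> means that \<open>Q\<close> lies above \<open>P\<close>.\<close>

definition between_layers :: "('s \<times> 's) set \<Rightarrow> 's \<Rightarrow> 's \<Rightarrow> 's \<Rightarrow> bool" where
  "between_layers L P Q R \<longleftrightarrow> (P, R) \<in> L \<and> (R, Q) \<in> L \<or> (Q, R) \<in> L \<and> (R, P) \<in> L"

text \<open>
  \<open>locally_same_side o' C A\<close>: near each point of the segment \<open>C\<close> other than its endpoint \<open>o'\<close>,
  all the sets in \<open>A\<close> lie in one and the same closed half-plane bounded by the line through \<open>C\<close>
  (with normal vector \<open>w\<close>). The endpoint, where \<open>C\<close> is not locally a line, is the image of the
  vertex.
\<close>

definition locally_same_side :: "complex \<Rightarrow> complex set \<Rightarrow> complex set set \<Rightarrow> bool" where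
  "locally_same_side o' C A \<longleftrightarrow>
     (\<exists>w. w \<noteq> 0 \<and> (\<forall>z\<in>C. w \<bullet> (z - o') = 0) \<and>
        (\<forall>S\<in>A. \<forall>x\<in>C - {o'}. \<exists>e>0. \<forall>z\<in>S \<inter> ball x e. 0 \<le> w \<bullet> (z - o')))"

definition disk_folds_flat ::
  "complex set set \<Rightarrow> (complex set \<Rightarrow> int) \<Rightarrow> complex \<Rightarrow> real \<Rightarrow> bool" where
  "disk_folds_flat E \<mu> v r \<longleftrightarrow>
     (\<exists>f L.
        continuous_on (cball v r) f \<and>
        (\<forall>S\<in>sectors E v r. direct_isometry_on S f \<or> opposite_isometry_on S f) \<and>
        (\<forall>c P Q. adjacent_sectors E v r c P Q \<longrightarrow>
           (direct_isometry_on P f \<longleftrightarrow> opposite_isometry_on Q f)) \<and>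
        (\<forall>p. p \<notin> f ` (\<Union>E \<inter> cball v r) \<longrightarrow>
           (let stack = {S \<in> sectors E v r. p \<in> f ` S}
            in strict_linear_order_on stack (L \<inter> stack \<times> stack))) \<and>
        (\<forall>c P Q. adjacent_sectors E v r c P Q \<and>
             direct_isometry_on P f \<and> opposite_isometry_on Q f \<longrightarrow>
           (\<mu> c = - 1 \<longrightarrow> (P, Q) \<in> L) \<and> (\<mu> c = 1 \<longrightarrow> (Q, P) \<in> L)) \<and>
        (\<forall>c P Q R. adjacent_sectors E v r c P Q \<and> R \<in> sectors E v r \<and>
             f ` (c \<inter> cball v r) \<inter> interior (f ` R) \<noteq> {} \<longrightarrow>
           \<not> between_layers L P Q R) \<and>
        (\<forall>c d P Q R T. c \<noteq> d \<and>
             adjacent_sectors E v r c P Q \<and> adjacent_sectors E v r d R T \<and>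
             f ` (c \<inter> cball v r) = f ` (d \<inter> cball v r) \<and>
             locally_same_side (f v) (f ` (c \<inter> cball v r)) {f ` P, f ` Q, f ` R, f ` T} \<longrightarrow>
           (between_layers L P Q R \<longleftrightarrow> between_layers L P Q T)))"

definition locally_folds_flat ::
  "complex set \<Rightarrow> complex set \<Rightarrow> complex set set \<Rightarrow> (complex set \<Rightarrow> int) \<Rightarrow> bool" where
  "locally_folds_flat X V E \<mu> \<longleftrightarrow>
     (\<forall>v\<in>V. \<exists>r. small_disk X V E v r \<and> disk_folds_flat E \<mu> v r)"

end

theory Submission
  imports Defs
begin

text \<open>
  Four creases meet at a corner of a central square, and the sectors between them have the angles
  \<open>135\<close>, \<open>90\<close>, \<open>45\<close>, \<open>90\<close>. Any flat folding of a small disk around the corner agrees, up to a rigid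
  motion, with one model folding (\<open>fold_pieces\<close>), because the isometry on a sector is determined by
  its orientation and by its values on the ray shared with the previous sector. In the model, the two
  creases that bound the sector of \<open>45\<close> degrees run across the interiors of other folded sectors,
  so no other layer may pass between the layers that they join. This leaves four layer orders, and
  they realise exactly the assignments with equal values on the two creases that bound the sector of
  \<open>135\<close> degrees and opposite values on the two creases that bound the sector of \<open>45\<close> degrees
  (\<open>disk_folds_flat_iff\<close>).

  A side of a central square bounds the sector of \<open>135\<close> degrees at one of its ends and the sector of
  \<open>45\<close> degrees at the other. The second crease bounding that sector is in both cases a crease of the
  pleat that starts from the side. Hence an assignment locally folds flat if and only if in every pleat
  the two creases have opposite values and every side has the value of one particular crease of its
  pleat (\<open>locally_folds_flat_grid_iff\<close>). Adjacent twists are mirror images of each other, so the two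
  sides at the ends of a common pleat are tied to the same crease. Therefore the values on one crease
  per pleat can be chosen freely and determine all others (\<open>card_coherent\<close>). A row contains \<open>n + 1\<close>
  pleats and a column \<open>m + 1\<close>, which makes \<open>m (n + 1) + n (m + 1) = 2 m n + m + n\<close> pleats
  (\<open>card_free_pleats\<close>).
\<close>

section \<open>Plane isometries\<close>

definition rigid :: "(complex \<Rightarrow> complex) \<Rightarrow> bool" where
  "rigid h \<longleftrightarrow> direct_isometry_on UNIV h \<or> opposite_isometry_on UNIV h"

text \<open>
  Orientation does not matter for metric and topological facts: either kind of isometry is a
  translation after an injective linear map, for which the library knows how interiors, closures
  and convex sets are mapped.
\<close>
lemma rigid_linear_part:
  assumes "rigid h"
  obtains b L where "linear L" "inj L" "\<And>z. norm (L z) = norm z" "h = (\<lambda>x. b + x) \<circ> L"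
proof -
  have "\<exists>L b. linear L \<and> (\<forall>z. norm (L z) = norm z) \<and> h = (\<lambda>x. b + x) \<circ> L"
    using assms unfolding rigid_def direct_isometry_on_def opposite_isometry_on_def
  proof (elim disjE exE conjE)
    fix u b :: complex
    assume "norm u = 1" "\<forall>z\<in>UNIV. h z = u * z + b"
    then show ?thesis
      by (intro exI[of _ "\<lambda>z. u * z"] exI[of _ b])
        (auto simp: fun_eq_iff norm_mult algebra_simps intro!: linearI)
  next
    fix u b :: complex
    assume "norm u = 1" "\<forall>z\<in>UNIV. h z = u * cnj z + b"
    then show ?thesis
      by (intro exI[of _ "\<lambda>z. u * cnj z"] exI[of _ b])
        (auto simp: fun_eq_iff norm_mult algebra_simps intro!: linearI)
  qed
  then obtain L b where L: "linear L" "\<And>z. norm (L z) = norm z" "h = (\<lambda>x. b + x) \<circ> L"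
    by blast
  then have "inj L"
    by (metis linear_injective_0 norm_eq_zero)
  with L show ?thesis
    using that by blast
qed

lemma rigid_dist: "rigid h \<Longrightarrow> dist (h x) (h y) = dist x y"
  by (elim rigid_linear_part) (simp add: dist_norm linear_diff[symmetric])

lemma rigid_inj: "rigid h \<Longrightarrow> inj h"
  by (metis injI rigid_dist dist_eq_0_iff)

lemma rigid_eq_iff: "rigid h \<Longrightarrow> h x = h y \<longleftrightarrow> x = y"
  using rigid_inj by (metis injD)

lemma rigid_mem_image: "rigid h \<Longrightarrow> h x \<in> h ` S \<longleftrightarrow> x \<in> S"
  using rigid_inj by (metis inj_image_mem_iff)

lemma rigid_surj: "rigid h \<Longrightarrow> surj h"
proof (elim rigid_linear_part)
  fix b and L :: "complex \<Rightarrow> complex"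
  assume "linear L" "inj L" "h = (\<lambda>x. b + x) \<circ> L"
  then show "surj h"
    by (metis comp_surj linear_injective_imp_surjective surj_plus)
qed

lemma rigid_interior: "rigid h \<Longrightarrow> interior (h ` S) = h ` interior S"
  by (elim rigid_linear_part)
    (metis image_comp interior_translation interior_injective_linear_image)

lemma rigid_closure: "rigid h \<Longrightarrow> closure (h ` S) = h ` closure S"
  by (elim rigid_linear_part)
    (metis image_comp closure_translation closure_injective_linear_image)

lemma rigid_open: "rigid h \<Longrightarrow> open S \<Longrightarrow> open (h ` S)"
  by (metis rigid_interior interior_eq)

lemma rigid_convex: "rigid h \<Longrightarrow> convex S \<Longrightarrow> convex (h ` S)"
  by (elim rigid_linear_part)
    (metis image_comp convex_translation convex_linear_image)

lemma rigid_image_ball: "rigid h \<Longrightarrow> h ` ball x r = ball (h x) r"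
  using rigid_surj by (fastforce simp: rigid_dist)

lemma rigid_image_cball: "rigid h \<Longrightarrow> h ` cball x r = cball (h x) r"
  using rigid_surj by (fastforce simp: rigid_dist)

lemma rigid_continuous: "rigid h \<Longrightarrow> continuous_on S h"
  by (auto simp: rigid_def direct_isometry_on_def opposite_isometry_on_def
      intro!: continuous_intros cong: continuous_on_cong)

lemma rigid_cnj: "rigid h \<Longrightarrow> rigid (\<lambda>z. cnj (h z))"
proof -
  have "direct_isometry_on UNIV h \<Longrightarrow> opposite_isometry_on UNIV (\<lambda>z. cnj (h z))"
    unfolding direct_isometry_on_def opposite_isometry_on_def
    by (metis complex_cnj_add complex_cnj_mult complex_mod_cnj)
  moreover have "opposite_isometry_on UNIV h \<Longrightarrow> direct_isometry_on UNIV (\<lambda>z. cnj (h z))"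
    unfolding direct_isometry_on_def opposite_isometry_on_def
    by (metis complex_cnj_add complex_cnj_mult complex_mod_cnj complex_cnj_cnj)
  ultimately show "rigid h \<Longrightarrow> rigid (\<lambda>z. cnj (h z))"
    unfolding rigid_def by blast
qed

lemma direct_isometryE:
  assumes "direct_isometry_on S f"
  obtains u b where "norm u = 1" "\<And>z. z \<in> S \<Longrightarrow> f z = u * z + b"
  using assms unfolding direct_isometry_on_def by blast

lemma opposite_isometryE:
  assumes "opposite_isometry_on S f"
  obtains u b where "norm u = 1" "\<And>z. z \<in> S \<Longrightarrow> f z = u * cnj z + b"
  using assms unfolding opposite_isometry_on_def by blast

lemma direct_isometryI:
  "norm u = 1 \<Longrightarrow> (\<And>z. z \<in> S \<Longrightarrow> f z = u * z + b) \<Longrightarrow> direct_isometry_on S f"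
  unfolding direct_isometry_on_def by blast

lemma opposite_isometryI:
  "norm u = 1 \<Longrightarrow> (\<And>z. z \<in> S \<Longrightarrow> f z = u * cnj z + b) \<Longrightarrow> opposite_isometry_on S f"
  unfolding opposite_isometry_on_def by blast

lemma orientation_comp:
  "direct_isometry_on UNIV h \<Longrightarrow> direct_isometry_on (h ` S) f \<Longrightarrow> direct_isometry_on S (f \<circ> h)"
  "direct_isometry_on UNIV h \<Longrightarrow> opposite_isometry_on (h ` S) f \<Longrightarrow> opposite_isometry_on S (f \<circ> h)"
  "opposite_isometry_on UNIV h \<Longrightarrow> direct_isometry_on (h ` S) f \<Longrightarrow> opposite_isometry_on S (f \<circ> h)"
  "opposite_isometry_on UNIV h \<Longrightarrow> opposite_isometry_on (h ` S) f \<Longrightarrow> direct_isometry_on S (f \<circ> h)"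
proof -
  assume h: "direct_isometry_on UNIV h" and f: "direct_isometry_on (h ` S) f"
  obtain u b where u: "norm u = 1" "\<And>z. z \<in> UNIV \<Longrightarrow> h z = u * z + b"
    using h by (rule direct_isometryE) (rule that)
  obtain w c where w: "norm w = 1" "\<And>z. z \<in> h ` S \<Longrightarrow> f z = w * z + c"
    using f by (rule direct_isometryE) (rule that)
  have fh: "f (h z) = w * (u * z + b) + c" if "z \<in> S" for z
    using w(2)[OF imageI[OF that]] u(2) by simp
  show "direct_isometry_on S (f \<circ> h)"
    by (rule direct_isometryI[of "w * u" _ _ "w * b + c"])
      (simp_all add: fh u(1) w(1) norm_mult algebra_simps)
next
  assume h: "direct_isometry_on UNIV h" and f: "opposite_isometry_on (h ` S) f"
  obtain u b where u: "norm u = 1" "\<And>z. z \<in> UNIV \<Longrightarrow> h z = u * z + b"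
    using h by (rule direct_isometryE) (rule that)
  obtain w c where w: "norm w = 1" "\<And>z. z \<in> h ` S \<Longrightarrow> f z = w * cnj z + c"
    using f by (rule opposite_isometryE) (rule that)
  have fh: "f (h z) = w * cnj (u * z + b) + c" if "z \<in> S" for z
    using w(2)[OF imageI[OF that]] u(2) by simp
  show "opposite_isometry_on S (f \<circ> h)"
    by (rule opposite_isometryI[of "w * cnj u" _ _ "w * cnj b + c"])
      (simp_all add: fh u(1) w(1) norm_mult algebra_simps)
next
  assume h: "opposite_isometry_on UNIV h" and f: "direct_isometry_on (h ` S) f"
  obtain u b where u: "norm u = 1" "\<And>z. z \<in> UNIV \<Longrightarrow> h z = u * cnj z + b"
    using h by (rule opposite_isometryE) (rule that)
  obtain w c where w: "norm w = 1" "\<And>z. z \<in> h ` S \<Longrightarrow> f z = w * z + c"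
    using f by (rule direct_isometryE) (rule that)
  have fh: "f (h z) = w * (u * cnj z + b) + c" if "z \<in> S" for z
    using w(2)[OF imageI[OF that]] u(2) by simp
  show "opposite_isometry_on S (f \<circ> h)"
    by (rule opposite_isometryI[of "w * u" _ _ "w * b + c"])
      (simp_all add: fh u(1) w(1) norm_mult algebra_simps)
next
  assume h: "opposite_isometry_on UNIV h" and f: "opposite_isometry_on (h ` S) f"
  obtain u b where u: "norm u = 1" "\<And>z. z \<in> UNIV \<Longrightarrow> h z = u * cnj z + b"
    using h by (rule opposite_isometryE) (rule that)
  obtain w c where w: "norm w = 1" "\<And>z. z \<in> h ` S \<Longrightarrow> f z = w * cnj z + c"
    using f by (rule opposite_isometryE) (rule that)
  have fh: "f (h z) = w * cnj (u * cnj z + b) + c" if "z \<in> S" for z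
    using w(2)[OF imageI[OF that]] u(2) by simp
  show "direct_isometry_on S (f \<circ> h)"
    by (rule direct_isometryI[of "w * cnj u" _ _ "w * cnj b + c"])
      (simp_all add: fh u(1) w(1) norm_mult algebra_simps)
qed

text \<open>
  An affine map that agrees with a direct and an opposite isometry at three points \<open>p\<close>, \<open>p + x\<close>,
  \<open>p + y\<close> satisfies \<open>u x = w cnj x\<close> and \<open>u y = w cnj y\<close>; multiplying crosswise shows that
  \<open>x cnj y\<close> is real, so the points are collinear.
\<close>
lemma orientation_exclusive:
  assumes "direct_isometry_on S f" "opposite_isometry_on S f"
    and "p \<in> S" "p + x \<in> S" "p + y \<in> S"
  shows "Im (x * cnj y) = 0"
proof -
  obtain u b where u: "norm u = 1" "\<And>z. z \<in> S \<Longrightarrow> f z = u * z + b"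
    using assms(1) unfolding direct_isometry_on_def by blast
  obtain w c where w: "norm w = 1" "\<And>z. z \<in> S \<Longrightarrow> f z = w * cnj z + c"
    using assms(2) unfolding opposite_isometry_on_def by blast
  have "u * p + b = w * cnj p + c" "u * (p + x) + b = w * cnj (p + x) + c"
    "u * (p + y) + b = w * cnj (p + y) + c"
    using u(2) w(2) assms(3-5) by metis+
  then have "u * (p + x) - u * p = w * cnj (p + x) - w * cnj p"
    "u * (p + y) - u * p = w * cnj (p + y) - w * cnj p"
    by (metis add_diff_cancel_right)+
  then have x: "u * x = w * cnj x" and y: "u * y = w * cnj y"
    by (simp_all add: distrib_left)
  have "u * w * (x * cnj y) = u * w * (cnj x * y)"
    by (metis x y mult.commute mult.left_commute)
  moreover have "u \<noteq> 0" "w \<noteq> 0"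
    using u(1) w(1) by auto
  ultimately have "x * cnj y = cnj x * y" by simp
  then show ?thesis
    by (simp add: complex_eq_iff)
qed

section \<open>The model corner\<close>

text \<open>
  The model of a corner of a central square: four rays from the origin in the directions
  \<open>0\<close>, \<open>135\<close>, \<open>225\<close> and \<open>270\<close> degrees, numbered \<open>0\<close> to \<open>3\<close>; wedge \<open>k\<close> lies between ray \<open>k\<close> and
  ray \<open>k + 1\<close>. The angles of the wedges are \<open>135\<close>, \<open>90\<close>, \<open>45\<close> and \<open>90\<close> degrees. The
  bounding lines have integer coefficients, so membership is linear arithmetic in the coordinates.
\<close>
definition wedge :: "nat \<Rightarrow> complex set" where
  "wedge k =
     (if k = 0 then {z. 0 \<le> Im z \<and> 0 \<le> Re z + Im z}
      else if k = 1 then {z. Re z + Im z \<le> 0 \<and> Re z \<le> Im z}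
      else if k = 2 then {z. Re z \<le> 0 \<and> Im z \<le> Re z}
      else {z. 0 \<le> Re z \<and> Im z \<le> 0})"

definition open_wedge :: "nat \<Rightarrow> complex set" where
  "open_wedge k =
     (if k = 0 then {z. 0 < Im z \<and> 0 < Re z + Im z}
      else if k = 1 then {z. Re z + Im z < 0 \<and> Re z < Im z}
      else if k = 2 then {z. Re z < 0 \<and> Im z < Re z}
      else {z. 0 < Re z \<and> Im z < 0})"

definition ray :: "nat \<Rightarrow> complex set" where
  "ray k =
     (if k = 0 then {z. 0 \<le> Re z \<and> Im z = 0}
      else if k = 1 then {z. 0 \<le> Im z \<and> Re z + Im z = 0}
      else if k = 2 then {z. Re z \<le> 0 \<and> Im z = Re z}
      else {z. Re z = 0 \<and> Im z \<le> 0})"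

text \<open>
  The flat folding that keeps wedge \<open>0\<close> fixed, wedge by wedge: the identity, the reflection in ray
  \<open>1\<close>, the half turn, and the reflection in ray \<open>0\<close>. The wedges \<open>0\<close> to \<open>3\<close> land on the angular
  ranges \<open>[0, 135]\<close>, \<open>[45, 135]\<close>, \<open>[45, 90]\<close> and \<open>[0, 90]\<close>.
\<close>
definition piece :: "nat \<Rightarrow> complex \<Rightarrow> complex" where
  "piece k z =
     (if k = 0 then z else if k = 1 then - \<i> * cnj z else if k = 2 then - z else cnj z)"

definition sector :: "real \<Rightarrow> nat \<Rightarrow> complex set" where
  "sector r k = wedge k \<inter> cball 0 r"

lemma less_4_cases: "(k::nat) < 4 \<Longrightarrow> (k = 0 \<Longrightarrow> P) \<Longrightarrow> (k = 1 \<Longrightarrow> P) \<Longrightarrow> (k = 2 \<Longrightarrow> P) \<Longrightarrow> (k = 3 \<Longrightarrow> P) \<Longrightarrow> P"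
  by linarith

lemma lessThan_4: "{..<4::nat} = {0, 1, 2, 3}"
  by auto

lemma wedge_halfspaces:
  obtains p q :: complex where "p \<noteq> 0" "q \<noteq> 0"
    "wedge k = {z. p \<bullet> z \<ge> 0} \<inter> {z. q \<bullet> z \<ge> 0}"
    "open_wedge k = {z. p \<bullet> z > 0} \<inter> {z. q \<bullet> z > 0}"
proof -
  consider "k = 0" | "k = 1" | "k = 2" | "k \<noteq> 0" "k \<noteq> 1" "k \<noteq> 2"
    by blast
  then show ?thesis
  proof cases
    case 1
    show ?thesis
      by (rule that[of "Complex 0 1" "Complex 1 1"])
        (use 1 in \<open>auto simp: wedge_def open_wedge_def inner_complex_def complex_eq_iff\<close>)
  next
    case 2
    show ?thesis
      by (rule that[of "Complex (-1) (-1)" "Complex (-1) 1"])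
        (use 2 in \<open>auto simp: wedge_def open_wedge_def inner_complex_def complex_eq_iff\<close>)
  next
    case 3
    show ?thesis
      by (rule that[of "Complex (-1) 0" "Complex 1 (-1)"])
        (use 3 in \<open>auto simp: wedge_def open_wedge_def inner_complex_def complex_eq_iff\<close>)
  next
    case 4
    show ?thesis
      by (rule that[of "Complex 1 0" "Complex 0 (-1)"])
        (use 4 in \<open>auto simp: wedge_def open_wedge_def inner_complex_def complex_eq_iff\<close>)
  qed
qed

lemma open_open_wedge: "open (open_wedge k)"
  by (rule wedge_halfspaces[of k]) (auto intro!: open_Int open_halfspace_gt)

lemma convex_open_wedge: "convex (open_wedge k)"
  by (rule wedge_halfspaces[of k]) (auto intro!: convex_Int convex_halfspace_gt)

lemma closed_wedge: "closed (wedge k)"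
  by (rule wedge_halfspaces[of k]) (auto intro!: closed_Int closed_halfspace_ge)

definition wedge_point :: "nat \<Rightarrow> complex" where
  "wedge_point k = (if k = 0 then Complex 0 1 else if k = 1 then Complex (-1) 0
     else if k = 2 then Complex (-1/4) (-3/4) else Complex (1/2) (-1/2))"

lemma wedge_point: "wedge_point k \<in> open_wedge k" "norm (wedge_point k) \<le> 1"
  by (auto simp: wedge_point_def open_wedge_def intro!: order_trans[OF cmod_le])

lemma scaled_wedge_point:
  assumes "r > 0"
  shows "of_real (r / 2) * wedge_point k \<in> open_wedge k \<inter> ball 0 r"
proof -
  have "of_real (r / 2) * wedge_point k \<in> open_wedge k"
    using wedge_point(1)[of k] assms
    by (auto simp: open_wedge_def divide_simps distrib_left[symmetric] mult_less_0_iff zero_less_mult_iff split: if_splits)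
  moreover have "norm (of_real (r / 2) * wedge_point k) < r"
    using mult_left_mono[OF wedge_point(2)[of k], of "r / 2"] assms by (simp add: norm_mult)
  ultimately show ?thesis by simp
qed

text \<open>
  The closure of an intersection of convex sets is the intersection of the closures as soon as
  the relative interiors meet, here in a multiple of \<open>wedge_point k\<close>.
\<close>
lemma closure_open_sector:
  assumes "r > 0"
  shows "closure (open_wedge k \<inter> ball 0 r) = sector r k"
proof -
  obtain p q :: complex where pq: "p \<noteq> 0" "q \<noteq> 0"
    "wedge k = {z. p \<bullet> z \<ge> 0} \<inter> {z. q \<bullet> z \<ge> 0}"
    "open_wedge k = {z. p \<bullet> z > 0} \<inter> {z. q \<bullet> z > 0}"
    by (rule wedge_halfspaces[of k])
  have ne: "open_wedge k \<inter> ball 0 r \<noteq> {}"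
    using scaled_wedge_point[OF assms] by blast
  have "closure (open_wedge k) = wedge k"
    unfolding pq using ne pq
    by (subst closure_Int_convex)
      (auto simp: convex_halfspace_gt rel_interior_open open_halfspace_gt)
  then show ?thesis
    unfolding sector_def using ne assms
    by (subst closure_Int_convex)
      (auto simp: convex_open_wedge rel_interior_open open_open_wedge)
qed

definition ray_point :: "nat \<Rightarrow> complex" where
  "ray_point k = (if k = 0 then Complex 1 0 else if k = 1 then Complex (-1/2) (1/2)
     else if k = 2 then Complex (-1/2) (-1/2) else Complex 0 (-1))"

lemma scaled_ray_point:
  assumes "r > 0"
  shows "of_real (r / 2) * ray_point k \<in> ray k \<inter> cball 0 r"
proof -
  have "norm (ray_point k) \<le> 1"
    by (auto simp: ray_point_def intro!: order_trans[OF cmod_le])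
  then have "norm (of_real (r / 2) * ray_point k) \<le> r"
    using mult_left_mono[of "norm (ray_point k)" 1 "r / 2"] assms by (simp add: norm_mult)
  then show ?thesis
    using assms by (auto simp: ray_def ray_point_def)
qed

lemma scaled_ray_point_wedge:
  assumes "r > 0" "i < 4" "k < 4" "of_real (r / 2) * ray_point k \<in> wedge i"
  shows "i = k \<or> i = (k + 3) mod 4"
  using assms(2,3)
  by (elim less_4_cases) (use assms(1,4) in \<open>auto simp: wedge_def ray_point_def\<close>)

lemma ray_subset_wedge: "k < 4 \<Longrightarrow> ray k \<subseteq> wedge k \<inter> wedge ((k + 3) mod 4)"
  by (elim less_4_cases) (auto simp: ray_def wedge_def)

lemma open_wedge_subset_wedge: "open_wedge k \<subseteq> wedge k"
  by (auto simp: open_wedge_def wedge_def)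

lemma open_wedge_disjoint_wedge:
  "i < 4 \<Longrightarrow> k < 4 \<Longrightarrow> z \<in> open_wedge i \<Longrightarrow> z \<in> wedge k \<Longrightarrow> i = k"
  by (elim less_4_cases) (auto simp: open_wedge_def wedge_def)

lemma UN_open_wedge: "(\<Union>k<4. open_wedge k) = - (\<Union>k<4. ray k)"
  by (auto simp: lessThan_4 open_wedge_def ray_def)

lemma UN_wedge: "(\<Union>k<4. wedge k) = UNIV"
  by (auto simp: lessThan_4 wedge_def)

text \<open>
  A disk whose creases form an isometric copy of the model corner; \<open>c k\<close> is the crease along ray
  \<open>k\<close>. The map \<open>\<phi>\<close> may reverse the orientation, as it does at the corners of every other cell.
\<close>
locale twist_vertex =
  fixes E :: "complex set set" and v :: complex and r :: real
    and \<phi> :: "complex \<Rightarrow> complex" and c :: "nat \<Rightarrow> complex set"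
  assumes rigid_phi: "rigid \<phi>" and phi_0: "\<phi> 0 = v" and r_pos: "0 < r"
    and creases_at: "{e \<in> E. v \<in> e} = c ` {..<4}"
    and crease_ray: "k < 4 \<Longrightarrow> c k \<inter> cball v r = \<phi> ` (ray k \<inter> cball 0 r)"
    and other_creases: "e \<in> E \<Longrightarrow> e \<inter> cball v r \<noteq> {} \<Longrightarrow> v \<in> e"
begin

abbreviation sec :: "nat \<Rightarrow> complex set" where
  "sec k \<equiv> \<phi> ` sector r k"

lemma crease_in: "k < 4 \<Longrightarrow> c k \<in> E \<and> v \<in> c k"
  using creases_at by blast

lemma Union_creases: "\<Union>E \<inter> cball v r = (\<Union>k<4. \<phi> ` (ray k \<inter> cball 0 r))"
proof -
  have "\<Union>E \<inter> cball v r = (\<Union>e\<in>{e \<in> E. v \<in> e}. e \<inter> cball v r)"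
    using other_creases by blast
  also have "\<dots> = (\<Union>k<4. c k \<inter> cball v r)"
    by (simp add: creases_at)
  finally show ?thesis
    using crease_ray by auto
qed

lemma components_disk:
  "components (ball v r - \<Union>E) = (\<lambda>k. \<phi> ` (open_wedge k \<inter> ball 0 r)) ` {..<4}"
proof (rule components_open_unique)
  have "\<phi> ` (open_wedge i \<inter> ball 0 r) \<inter> \<phi> ` (open_wedge k \<inter> ball 0 r) = {}"
    if "i < 4" "k < 4" "i \<noteq> k" for i k
    using that open_wedge_disjoint_wedge open_wedge_subset_wedge
    by (auto simp: rigid_eq_iff[OF rigid_phi] subset_iff)
  then show "pairwise disjnt ((\<lambda>k. \<phi> ` (open_wedge k \<inter> ball 0 r)) ` {..<4})"
    unfolding pairwise_def disjnt_def by blast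
  have "ball v r - \<Union>E = ball v r - (\<Union>E \<inter> cball v r)"
    by auto
  also have "\<dots> = \<phi> ` ball 0 r - \<phi> ` (\<Union>k<4. (ray k \<inter> cball 0 r))"
    unfolding Union_creases
    by (simp only: rigid_image_ball[OF rigid_phi] phi_0 image_UN)
  also have "\<dots> = \<phi> ` (ball 0 r - (\<Union>k<4. ray k))"
    by (subst image_set_diff[OF rigid_inj[OF rigid_phi], symmetric]) (auto intro!: image_eqI)
  also have "ball 0 r - (\<Union>k<4. ray k) = (\<Union>k<4. open_wedge k \<inter> ball 0 r)"
    using UN_open_wedge by blast
  finally show "\<Union>((\<lambda>k. \<phi> ` (open_wedge k \<inter> ball 0 r)) ` {..<4}) = ball v r - \<Union>E"
    by (simp only: image_UN)
next
  fix X assume "X \<in> (\<lambda>k. \<phi> ` (open_wedge k \<inter> ball 0 r)) ` {..<4}"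
  then obtain k where X: "X = \<phi> ` (open_wedge k \<inter> ball 0 r)" by blast
  show "open X \<and> connected X \<and> X \<noteq> {}"
    unfolding X using scaled_wedge_point[OF r_pos, of k]
    by (auto intro!: rigid_open rigid_convex rigid_phi convex_connected convex_Int
        convex_open_wedge open_open_wedge)
qed

lemma sectors_eq: "sectors E v r = sec ` {..<4}"
  unfolding sectors_def components_disk
  by (simp add: image_image rigid_closure[OF rigid_phi] closure_open_sector[OF r_pos])

lemma sec_inj:
  assumes "i < 4" "k < 4" shows "sec i = sec k \<longleftrightarrow> i = k"
proof
  assume "sec i = sec k"
  then have "sector r i = sector r k"
    using rigid_inj[OF rigid_phi] by (metis inj_image_eq_iff)
  then show "i = k"
    using scaled_wedge_point[OF r_pos, of i] assms open_wedge_disjoint_wedge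
      open_wedge_subset_wedge
    unfolding sector_def by (metis IntD1 IntD2 IntI ball_subset_cball subset_iff)
qed simp

lemma adjacent_iff:
  "adjacent_sectors E v r e P Q \<longleftrightarrow>
    (\<exists>k<4. e = c k \<and>
      (P = sec k \<and> Q = sec ((k + 3) mod 4) \<or> P = sec ((k + 3) mod 4) \<and> Q = sec k))"
    (is "_ \<longleftrightarrow> ?R")
proof
  assume adj: "adjacent_sectors E v r e P Q"
  then have "e \<in> c ` {..<4}" "P \<in> sec ` {..<4}" "Q \<in> sec ` {..<4}"
    unfolding adjacent_sectors_def sectors_eq creases_at[symmetric] by simp_all
  then obtain k i j where k: "k < 4" "e = c k"
    and ij: "i < 4" "j < 4" "P = sec i" "Q = sec j"
    by (auto elim!: imageE)
  have "i \<noteq> j" "e \<inter> cball v r \<subseteq> P \<inter> Q"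
    using adj ij unfolding adjacent_sectors_def by auto
  moreover have "\<phi> (of_real (r / 2) * ray_point k) \<in> e \<inter> cball v r"
    using scaled_ray_point[OF r_pos, of k] unfolding k(2) crease_ray[OF k(1)] by blast
  ultimately have "of_real (r / 2) * ray_point k \<in> sector r i \<inter> sector r j"
    unfolding ij by (metis IntD1 IntD2 IntI rigid_mem_image[OF rigid_phi] subsetD)
  then have "of_real (r / 2) * ray_point k \<in> wedge i \<inter> wedge j"
    unfolding sector_def by blast
  then have "i = k \<or> i = (k + 3) mod 4" "j = k \<or> j = (k + 3) mod 4"
    using scaled_ray_point_wedge[OF r_pos] k ij by blast+
  with \<open>i \<noteq> j\<close> k ij show ?R by auto
next
  assume ?R
  then obtain k where k: "k < 4" "e = c k"
    and PQ: "P = sec k \<and> Q = sec ((k + 3) mod 4) \<or> P = sec ((k + 3) mod 4) \<and> Q = sec k"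
    by blast
  have ne: "k \<noteq> (k + 3) mod 4"
    using k(1) by (elim less_4_cases) auto
  have "c k \<inter> cball v r \<subseteq> sec k \<inter> sec ((k + 3) mod 4)"
    using ray_subset_wedge[OF k(1)] unfolding crease_ray[OF k(1)] sector_def by blast
  then show "adjacent_sectors E v r e P Q"
    using PQ k crease_in[OF k(1)] ne unfolding adjacent_sectors_def sectors_eq
    by (auto simp: sec_inj)
qed

end

section \<open>The normal form of a folding\<close>

text \<open>
  A map that is alternately direct and opposite is determined on each sector by its values on the
  previous one: two neighbouring sectors share a ray, and a ray together with the orientation fixes
  the isometry. Up to a rigid motion this gives the model folding.
\<close>
lemma fold_pieces_from_direct:
  assumes "r > 0"
    and pattern: "direct_isometry_on (sector r 0) h \<and> opposite_isometry_on (sector r 1) h \<and>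
      direct_isometry_on (sector r 2) h \<and> opposite_isometry_on (sector r 3) h"
  shows "\<exists>\<psi>. rigid \<psi> \<and> (\<forall>k<4. \<forall>z\<in>sector r k. h z = \<psi> (piece k z))"
proof -
  obtain u0 b0 where 0: "norm u0 = 1" "\<And>z. z \<in> sector r 0 \<Longrightarrow> h z = u0 * z + b0"
    using pattern unfolding direct_isometry_on_def by blast
  obtain u1 b1 where 1: "norm u1 = 1" "\<And>z. z \<in> sector r 1 \<Longrightarrow> h z = u1 * cnj z + b1"
    using pattern unfolding opposite_isometry_on_def by blast
  obtain u2 b2 where 2: "norm u2 = 1" "\<And>z. z \<in> sector r 2 \<Longrightarrow> h z = u2 * z + b2"
    using pattern unfolding direct_isometry_on_def by blast
  obtain u3 b3 where 3: "norm u3 = 1" "\<And>z. z \<in> sector r 3 \<Longrightarrow> h z = u3 * cnj z + b3"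
    using pattern unfolding opposite_isometry_on_def by blast
  have "0 \<in> sector r k" for k
    using assms(1) by (auto simp: sector_def wedge_def)
  then have b: "b1 = b0" "b2 = b0" "b3 = b0"
    using 0(2)[of 0] 1(2)[of 0] 2(2)[of 0] 3(2)[of 0] by auto
  define s where "s = complex_of_real (r / 2)"
  have s: "s \<noteq> 0" using assms(1) by (simp add: s_def)
  have turned: "s * ray_point k \<in> sector r k" "s * ray_point k \<in> sector r ((k + 3) mod 4)"
    if "k < 4" for k
    using scaled_ray_point[OF assms(1), of k] ray_subset_wedge[OF that]
    unfolding sector_def s_def by blast+
  have c0: "u3 * cnj (s * ray_point 0) = u0 * (s * ray_point 0)"
    using 0(2)[of "s * ray_point 0"] 3(2)[of "s * ray_point 0"] turned[of 0] b by simp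
  have c1: "u1 * cnj (s * ray_point 1) = u0 * (s * ray_point 1)"
    using 0(2)[of "s * ray_point 1"] 1(2)[of "s * ray_point 1"] turned[of 1] b by simp
  have c2: "u2 * (s * ray_point 2) = u1 * cnj (s * ray_point 2)"
    using 1(2)[of "s * ray_point 2"] 2(2)[of "s * ray_point 2"] turned[of 2] b by simp
  have cs: "cnj s = s" by (simp add: s_def)
  have ray_points: "ray_point 1 = (- 1 + \<i>) / 2" "cnj (ray_point 1) = (- 1 - \<i>) / 2"
    "ray_point 2 = (- 1 - \<i>) / 2" "cnj (ray_point 2) = (- 1 + \<i>) / 2"
    by (simp_all add: ray_point_def complex_eq_iff)
  have nz: "s / 2 \<noteq> 0" "- 1 - \<i> \<noteq> 0"
    using s by (simp_all add: complex_eq_iff)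
  have half: "s / 2 * (p * x) = s / 2 * (q * y)" if "p * (s * (x / 2)) = q * (s * (y / 2))" for p q x y
    using that by (simp add: mult_ac)
  have u3: "u3 = u0"
    using c0 s by (simp add: cs ray_point_def Complex_eq)
  have u1: "u1 = - \<i> * u0"
  proof -
    have "(s / 2) * (u1 * (- 1 - \<i>)) = (s / 2) * (u0 * (- 1 + \<i>))"
      using c1 unfolding complex_cnj_mult cs ray_points(2,4) unfolding ray_points(1,3) by (rule half)
    then have "u1 * (- 1 - \<i>) = u0 * (- 1 + \<i>)"
      using nz(1) mult_left_cancel by blast
    also have "\<dots> = (- \<i> * u0) * (- 1 - \<i>)"
      by (simp add: algebra_simps)
    finally show ?thesis
      using nz(2) mult_right_cancel by blast
  qed
  have u2: "u2 = - u0"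
  proof -
    have "(s / 2) * (u2 * (- 1 - \<i>)) = (s / 2) * (u1 * (- 1 + \<i>))"
      using c2 unfolding complex_cnj_mult cs ray_points(2,4) unfolding ray_points(1,3) by (rule half)
    then have "u2 * (- 1 - \<i>) = u1 * (- 1 + \<i>)"
      using nz(1) mult_left_cancel by blast
    also have "\<dots> = - u0 * (- 1 - \<i>)"
      by (simp add: u1 algebra_simps)
    finally show ?thesis
      using nz(2) mult_right_cancel by blast
  qed
  have "h z = u0 * piece k z + b0" if "k < 4" "z \<in> sector r k" for k z
    using that(1) by (elim less_4_cases)
      (use that 0(2) 1(2) 2(2) 3(2) in \<open>simp_all add: piece_def b u1 u2 u3\<close>)
  moreover have "rigid (\<lambda>z. u0 * z + b0)"
    unfolding rigid_def direct_isometry_on_def using 0(1) by blast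
  ultimately show ?thesis by blast
qed

lemma orientation_inv:
  "direct_isometry_on UNIV h \<Longrightarrow> direct_isometry_on UNIV (inv h)"
  "opposite_isometry_on UNIV h \<Longrightarrow> opposite_isometry_on UNIV (inv h)"
proof -
  assume "direct_isometry_on UNIV h"
  then obtain u b where u: "norm u = 1" "\<And>z. h z = u * z + b"
    unfolding direct_isometry_on_def by blast
  then have "inv h y = cnj u * y - cnj u * b" for y
    by (intro inv_f_eq rigid_inj)
      (auto simp: rigid_def direct_isometry_on_def algebra_simps complex_norm_square[symmetric])
  then show "direct_isometry_on UNIV (inv h)"
    unfolding direct_isometry_on_def using u(1)
    by (intro exI[of _ "cnj u"] exI[of _ "- cnj u * b"]) auto
next
  assume "opposite_isometry_on UNIV h"
  then obtain u b where u: "norm u = 1" "\<And>z. h z = u * cnj z + b"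
    unfolding opposite_isometry_on_def by blast
  then have "inv h y = u * cnj y - u * cnj b" for y
    by (intro inv_f_eq rigid_inj)
      (auto simp: rigid_def opposite_isometry_on_def algebra_simps complex_norm_square[symmetric])
  then show "opposite_isometry_on UNIV (inv h)"
    unfolding opposite_isometry_on_def using u(1)
    by (intro exI[of _ "u"] exI[of _ "- u * cnj b"]) auto
qed

lemma rigid_inv: "rigid h \<Longrightarrow> rigid (inv h)"
  using orientation_inv unfolding rigid_def by blast

lemma orientation_post:
  "direct_isometry_on UNIV h \<Longrightarrow> direct_isometry_on S f \<Longrightarrow> direct_isometry_on S (h \<circ> f)"
  "direct_isometry_on UNIV h \<Longrightarrow> opposite_isometry_on S f \<Longrightarrow> opposite_isometry_on S (h \<circ> f)"
  "opposite_isometry_on UNIV h \<Longrightarrow> direct_isometry_on S f \<Longrightarrow> opposite_isometry_on S (h \<circ> f)"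
  "opposite_isometry_on UNIV h \<Longrightarrow> opposite_isometry_on S f \<Longrightarrow> direct_isometry_on S (h \<circ> f)"
proof -
  assume h: "direct_isometry_on UNIV h" and f: "direct_isometry_on S f"
  obtain u b where u: "norm u = 1" "\<And>z. z \<in> UNIV \<Longrightarrow> h z = u * z + b"
    using h by (rule direct_isometryE) (rule that)
  obtain w c where w: "norm w = 1" "\<And>z. z \<in> S \<Longrightarrow> f z = w * z + c"
    using f by (rule direct_isometryE) (rule that)
  show "direct_isometry_on S (h \<circ> f)"
    by (rule direct_isometryI[of "u * w" _ _ "u * c + b"])
      (simp_all add: u w norm_mult algebra_simps)
next
  assume h: "direct_isometry_on UNIV h" and f: "opposite_isometry_on S f"
  obtain u b where u: "norm u = 1" "\<And>z. z \<in> UNIV \<Longrightarrow> h z = u * z + b"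
    using h by (rule direct_isometryE) (rule that)
  obtain w c where w: "norm w = 1" "\<And>z. z \<in> S \<Longrightarrow> f z = w * cnj z + c"
    using f by (rule opposite_isometryE) (rule that)
  show "opposite_isometry_on S (h \<circ> f)"
    by (rule opposite_isometryI[of "u * w" _ _ "u * c + b"])
      (simp_all add: u w norm_mult algebra_simps)
next
  assume h: "opposite_isometry_on UNIV h" and f: "direct_isometry_on S f"
  obtain u b where u: "norm u = 1" "\<And>z. z \<in> UNIV \<Longrightarrow> h z = u * cnj z + b"
    using h by (rule opposite_isometryE) (rule that)
  obtain w c where w: "norm w = 1" "\<And>z. z \<in> S \<Longrightarrow> f z = w * z + c"
    using f by (rule direct_isometryE) (rule that)
  show "opposite_isometry_on S (h \<circ> f)"
    by (rule opposite_isometryI[of "u * cnj w" _ _ "u * cnj c + b"])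
      (simp_all add: u w norm_mult algebra_simps)
next
  assume h: "opposite_isometry_on UNIV h" and f: "opposite_isometry_on S f"
  obtain u b where u: "norm u = 1" "\<And>z. z \<in> UNIV \<Longrightarrow> h z = u * cnj z + b"
    using h by (rule opposite_isometryE) (rule that)
  obtain w c where w: "norm w = 1" "\<And>z. z \<in> S \<Longrightarrow> f z = w * cnj z + c"
    using f by (rule opposite_isometryE) (rule that)
  show "direct_isometry_on S (h \<circ> f)"
    by (rule direct_isometryI[of "u * cnj w" _ _ "u * cnj c + b"])
      (simp_all add: u w norm_mult algebra_simps)
qed

lemma conj_orientation: "opposite_isometry_on S cnj"
  unfolding opposite_isometry_on_def by (intro exI[of _ 1] exI[of _ 0]) auto

text \<open>
  The two possible alternating patterns differ by a reflection of the target plane.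
\<close>
lemma fold_pieces:
  assumes "r > 0"
    and "direct_isometry_on (sector r 0) h \<and> opposite_isometry_on (sector r 1) h \<and>
        direct_isometry_on (sector r 2) h \<and> opposite_isometry_on (sector r 3) h \<or>
      opposite_isometry_on (sector r 0) h \<and> direct_isometry_on (sector r 1) h \<and>
        opposite_isometry_on (sector r 2) h \<and> direct_isometry_on (sector r 3) h"
  shows "\<exists>\<psi>. rigid \<psi> \<and> (\<forall>k<4. \<forall>z\<in>sector r k. h z = \<psi> (piece k z))"
  using assms(2)
proof
  assume "opposite_isometry_on (sector r 0) h \<and> direct_isometry_on (sector r 1) h \<and>
    opposite_isometry_on (sector r 2) h \<and> direct_isometry_on (sector r 3) h"
  then obtain \<psi> where "rigid \<psi>" "\<forall>k<4. \<forall>z\<in>sector r k. (cnj \<circ> h) z = \<psi> (piece k z)"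
    using fold_pieces_from_direct[OF assms(1), of "cnj \<circ> h"] orientation_post(3,4)[OF conj_orientation]
    by blast
  then have "rigid (\<lambda>z. cnj (\<psi> z)) \<and> (\<forall>k<4. \<forall>z\<in>sector r k. h z = cnj (\<psi> (piece k z)))"
    using rigid_cnj by (metis comp_apply complex_cnj_cnj)
  then show ?thesis by blast
qed (use fold_pieces_from_direct[OF assms(1)] in blast)

lemma piece_orientation:
  "direct_isometry_on S (piece 0)" "opposite_isometry_on S (piece 1)"
  "direct_isometry_on S (piece 2)" "opposite_isometry_on S (piece 3)"
  unfolding direct_isometry_on_def opposite_isometry_on_def piece_def
  by (auto intro: exI[of _ 0] exI[of _ 1] exI[of _ "-1"] exI[of _ "- \<i>"])

lemma rigid_piece: "rigid (piece k)"
proof -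
  have "piece k = piece 0 \<or> piece k = piece 1 \<or> piece k = piece 2 \<or> piece k = piece 3"
    by (auto simp: fun_eq_iff piece_def)
  then show ?thesis
    using piece_orientation unfolding rigid_def by metis
qed

lemma open_wedge_interior_sector: "open_wedge k \<inter> ball 0 r \<subseteq> interior (sector r k)"
  unfolding sector_def
  by (rule interior_maximal)
    (use open_wedge_subset_wedge in \<open>auto simp: open_open_wedge intro!: open_Int\<close>)

lemma half_scaled_in_ball:
  "r > 0 \<Longrightarrow> norm w \<le> 1 \<Longrightarrow> of_real (r / 2) * w \<in> ball 0 r" for w :: complex
  using mult_left_mono[of "norm w" 1 "r / 2"] by (simp add: norm_mult)

section \<open>Necessary conditions at a corner\<close>

lemma inner_real_scale: "p \<bullet> (of_real t * w) = t * (p \<bullet> w)" for p w :: complex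
  by (simp add: inner_complex_def algebra_simps)

lemma scaled_open_wedge: "t > 0 \<Longrightarrow> w \<in> open_wedge k \<Longrightarrow> of_real t * w \<in> open_wedge k"
  by (rule wedge_halfspaces[of k]) (simp add: inner_real_scale)

lemma piece_scale: "piece k (of_real t * w) = of_real t * piece k w"
  by (simp add: piece_def)

lemma interior_folded_sector:
  assumes "r > 0" "w \<in> open_wedge k" "norm w \<le> 1"
  shows "of_real (r / 2) * piece k w \<in> interior (piece k ` sector r k)"
proof -
  have "of_real (r / 2) * w \<in> open_wedge k \<inter> ball 0 r"
    using half_scaled_in_ball[OF assms(1,3)] scaled_open_wedge[OF half_gt_zero[OF assms(1)] assms(2)]
    by blast
  then have "of_real (r / 2) * w \<in> interior (sector r k)"
    using open_wedge_interior_sector by (rule rev_subsetD)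
  then have "piece k (of_real (r / 2) * w) \<in> piece k ` interior (sector r k)"
    by (rule imageI)
  then show ?thesis
    by (simp only: rigid_interior[OF rigid_piece] piece_scale)
qed

text \<open>
  The line that carries the image of ray \<open>k\<close> under the model folding. The four lines are distinct,
  so no two creases have the same image.
\<close>
definition fold_line :: "nat \<Rightarrow> complex set" where
  "fold_line k =
     (if k = 0 then {z. Im z = 0} else if k = 1 then {z. Re z + Im z = 0}
      else if k = 2 then {z. Re z = Im z} else {z. Re z = 0})"

lemma piece_ray: "k < 4 \<Longrightarrow> z \<in> ray k \<Longrightarrow> piece k z \<in> fold_line k"
  by (elim less_4_cases) (auto simp: fold_line_def ray_def piece_def)

text \<open>
  The crossing conditions put the sectors \<open>1\<close>, \<open>2\<close>, \<open>3\<close> into consecutive layers in this order or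
  its reverse, with sector \<open>0\<close> below or above all of them. The two equivalences read off the
  mountain-valley pattern of these four orders.
\<close>
lemma layer_order:
  assumes lin: "strict_linear_order_on (A ` {..<4::nat}) (L \<inter> A ` {..<4} \<times> A ` {..<4})"
    and inj: "inj_on A {..<4}"
    and "\<not> between_layers L (A 2) (A 1) (A 0)" "\<not> between_layers L (A 2) (A 1) (A 3)"
    and "\<not> between_layers L (A 3) (A 2) (A 0)" "\<not> between_layers L (A 3) (A 2) (A 1)"
  shows "(A 0, A 1) \<in> L \<longleftrightarrow> (A 0, A 3) \<in> L" "(A 2, A 1) \<in> L \<longleftrightarrow> (A 3, A 2) \<in> L"
    and "i < 4 \<Longrightarrow> k < 4 \<Longrightarrow> i \<noteq> k \<Longrightarrow> (A i, A k) \<in> L \<longleftrightarrow> (A k, A i) \<notin> L"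
proof -
  have tr: "(A i, A k) \<in> L" if "(A i, A j) \<in> L" "(A j, A k) \<in> L" "i < 4" "j < 4" "k < 4" for i j k
    using lin that unfolding strict_linear_order_on_def trans_def by blast
  have irr: "(A i, A i) \<notin> L" if "i < 4" for i
    using lin that unfolding strict_linear_order_on_def irrefl_def by blast
  have tot: "(A i, A k) \<in> L \<or> (A k, A i) \<in> L" if "i < 4" "k < 4" "i \<noteq> k" for i k
    using lin that inj unfolding strict_linear_order_on_def total_on_def inj_on_def by blast
  show asym: "(A i, A k) \<in> L \<longleftrightarrow> (A k, A i) \<notin> L" if "i < 4" "k < 4" "i \<noteq> k" for i k
    using tr irr tot that by blast
  have asyms: "(A 1, A 0) \<in> L \<longleftrightarrow> (A 0, A 1) \<notin> L" "(A 2, A 0) \<in> L \<longleftrightarrow> (A 0, A 2) \<notin> L"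
    "(A 3, A 0) \<in> L \<longleftrightarrow> (A 0, A 3) \<notin> L" "(A 2, A 1) \<in> L \<longleftrightarrow> (A 1, A 2) \<notin> L"
    "(A 3, A 1) \<in> L \<longleftrightarrow> (A 1, A 3) \<notin> L" "(A 3, A 2) \<in> L \<longleftrightarrow> (A 2, A 3) \<notin> L"
    by (rule asym; simp)+
  show "(A 0, A 1) \<in> L \<longleftrightarrow> (A 0, A 3) \<in> L" "(A 2, A 1) \<in> L \<longleftrightarrow> (A 3, A 2) \<in> L"
    using assms(3-6) unfolding between_layers_def asyms by blast+
qed

context twist_vertex
begin

text \<open>
  Sector \<open>k\<close> starts at ray \<open>k\<close>, so the other sector at ray \<open>k\<close> is the cyclic predecessor
  \<open>(k + 3) mod 4\<close>.
\<close>
lemma crease_adjacent: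
  assumes "k < 4"
  shows "adjacent_sectors E v r (c k) (sec k) (sec ((k + 3) mod 4))"
    and "adjacent_sectors E v r (c k) (sec ((k + 3) mod 4)) (sec k)"
  unfolding adjacent_iff by (rule exI[of _ k], simp add: assms)+

text \<open>
  After the folding has been brought to normal form, one point is covered by all four sectors, so
  their layers are totally ordered. The images of the creases \<open>2\<close> and \<open>3\<close>, the sides of the
  sector of \<open>45\<close> degrees, run through the interiors of the other folded sectors, which is what
  \<open>layer_order\<close> needs.
\<close>
lemma crease_conditions_if_folds_flat:
  assumes flat: "disk_folds_flat E \<mu> v r"
    and mu_pm1: "\<And>k. k < 4 \<Longrightarrow> \<mu> (c k) = - 1 \<or> \<mu> (c k) = 1"
  shows "\<mu> (c 0) = \<mu> (c 1) \<and> \<mu> (c 2) = - \<mu> (c 3)"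
proof -
  obtain f L where
    iso: "\<And>S. S \<in> sectors E v r \<Longrightarrow> direct_isometry_on S f \<or> opposite_isometry_on S f" and
    alt: "\<And>e P Q. adjacent_sectors E v r e P Q \<Longrightarrow>
      direct_isometry_on P f \<longleftrightarrow> opposite_isometry_on Q f" and
    stack: "\<And>p. p \<notin> f ` (\<Union>E \<inter> cball v r) \<Longrightarrow>
      strict_linear_order_on {S \<in> sectors E v r. p \<in> f ` S}
        (L \<inter> {S \<in> sectors E v r. p \<in> f ` S} \<times> {S \<in> sectors E v r. p \<in> f ` S})" and
    mv: "\<And>e P Q. adjacent_sectors E v r e P Q \<Longrightarrow> direct_isometry_on P f \<Longrightarrow>
      opposite_isometry_on Q f \<Longrightarrow> (\<mu> e = - 1 \<longrightarrow> (P, Q) \<in> L) \<and> (\<mu> e = 1 \<longrightarrow> (Q, P) \<in> L)" and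
    cross: "\<And>e P Q R. adjacent_sectors E v r e P Q \<Longrightarrow> R \<in> sectors E v r \<Longrightarrow>
      f ` (e \<inter> cball v r) \<inter> interior (f ` R) \<noteq> {} \<Longrightarrow> \<not> between_layers L P Q R"
    using flat unfolding disk_folds_flat_def Let_def
    apply (elim exE conjE)
    subgoal for f L by (rule that[of f L]; blast)
    done
  have adj: "adjacent_sectors E v r (c 0) (sec 0) (sec 3)"
    "adjacent_sectors E v r (c 0) (sec 3) (sec 0)"
    "adjacent_sectors E v r (c 1) (sec 1) (sec 0)"
    "adjacent_sectors E v r (c 1) (sec 0) (sec 1)"
    "adjacent_sectors E v r (c 2) (sec 2) (sec 1)"
    "adjacent_sectors E v r (c 2) (sec 1) (sec 2)"
    "adjacent_sectors E v r (c 3) (sec 3) (sec 2)"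
    "adjacent_sectors E v r (c 3) (sec 2) (sec 3)"
    using crease_adjacent[of 0] crease_adjacent[of 1] crease_adjacent[of 2] crease_adjacent[of 3]
    by simp_all
  have "sec 0 \<in> sectors E v r"
    by (simp add: sectors_eq)
  then have pattern: "direct_isometry_on (sec 0) f \<and> opposite_isometry_on (sec 1) f \<and>
        direct_isometry_on (sec 2) f \<and> opposite_isometry_on (sec 3) f \<or>
      opposite_isometry_on (sec 0) f \<and> direct_isometry_on (sec 1) f \<and>
        opposite_isometry_on (sec 2) f \<and> direct_isometry_on (sec 3) f"
    using iso[of "sec 0"] alt[OF adj(3)] alt[OF adj(4)] alt[OF adj(5)] alt[OF adj(6)]
      alt[OF adj(7)] alt[OF adj(8)] by blast
  have "\<exists>\<psi>. rigid \<psi> \<and> (\<forall>k<4. \<forall>z\<in>sector r k. (f \<circ> \<phi>) z = \<psi> (piece k z))"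
  proof (rule fold_pieces[OF r_pos])
    show "direct_isometry_on (sector r 0) (f \<circ> \<phi>) \<and> opposite_isometry_on (sector r 1) (f \<circ> \<phi>) \<and>
        direct_isometry_on (sector r 2) (f \<circ> \<phi>) \<and> opposite_isometry_on (sector r 3) (f \<circ> \<phi>) \<or>
      opposite_isometry_on (sector r 0) (f \<circ> \<phi>) \<and> direct_isometry_on (sector r 1) (f \<circ> \<phi>) \<and>
        opposite_isometry_on (sector r 2) (f \<circ> \<phi>) \<and> direct_isometry_on (sector r 3) (f \<circ> \<phi>)"
      using pattern rigid_phi unfolding rigid_def by (metis orientation_comp)
  qed
  then obtain \<psi> where psi: "rigid \<psi>"
    and f: "\<And>k z. k < 4 \<Longrightarrow> z \<in> sector r k \<Longrightarrow> f (\<phi> z) = \<psi> (piece k z)"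
    by auto
  have f_sec: "f ` sec k = \<psi> ` piece k ` sector r k" if "k < 4" for k
    using f[OF that] by (simp add: image_image)
  have ray_sector: "ray k \<inter> cball 0 r \<subseteq> sector r k" if "k < 4" for k
    using ray_subset_wedge[OF that] unfolding sector_def by blast
  have f_crease: "f ` (c k \<inter> cball v r) = \<psi> ` piece k ` (ray k \<inter> cball 0 r)" if "k < 4" for k
    unfolding crease_ray[OF that] image_image using f[OF that] ray_sector[OF that]
    by (intro image_cong) auto

  define s where "s = complex_of_real (r / 2)"
  have s: "s \<noteq> 0" using r_pos by (simp add: s_def)
  \<comment> \<open>a point between the directions of \<open>45\<close> and \<open>90\<close> degrees, where all four sectors overlap\<close>
  define p where "p = Complex (1/4) (1/2)"
  have off_creases: "\<psi> (s * p) \<notin> f ` (\<Union>E \<inter> cball v r)"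
  proof
    assume "\<psi> (s * p) \<in> f ` (\<Union>E \<inter> cball v r)"
    then obtain k where k: "k < 4" "\<psi> (s * p) \<in> f ` (c k \<inter> cball v r)"
      unfolding Union_creases using crease_ray by auto
    then have "s * p \<in> piece k ` ray k"
      unfolding f_crease[OF k(1)] by (auto simp: rigid_eq_iff[OF psi])
    then have "s * p \<in> fold_line k"
      using piece_ray[OF k(1)] by auto
    then show False
      using k(1) r_pos by (elim less_4_cases) (auto simp: fold_line_def s_def p_def)
  qed
  have "\<psi> (s * p) \<in> f ` sec k" if k: "k < 4" for k
  proof -
    define q where "q = (if k = 0 then p else if k = 1 then Complex (-1/2) (-1/4)
      else if k = 2 then Complex (-1/4) (-1/2) else Complex (1/4) (-1/2))"
    have "q \<in> open_wedge k" "piece k q = p" "norm q \<le> 1"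
      using k by (elim less_4_cases; auto simp: q_def p_def open_wedge_def piece_def
          complex_eq_iff intro!: order_trans[OF cmod_le])+
    then have "s * p \<in> piece k ` sector r k"
      using interior_folded_sector[OF r_pos, of q k] interior_subset unfolding s_def by blast
    then show ?thesis
      by (simp add: f_sec[OF k] rigid_mem_image[OF psi])
  qed
  then have full_stack: "{S \<in> sectors E v r. \<psi> (s * p) \<in> f ` S} = sec ` {..<4}"
    unfolding sectors_eq by blast
  have lin: "strict_linear_order_on (sec ` {..<4}) (L \<inter> sec ` {..<4} \<times> sec ` {..<4})"
    using stack[OF off_creases] unfolding full_stack .
  have meets: "f ` (c k \<inter> cball v r) \<inter> interior (f ` sec i) \<noteq> {}"
    if "k < 4" "i < 4" "q \<in> open_wedge i" "piece i q = piece k (ray_point k)" "norm q \<le> 1"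
    for i k q
  proof -
    have "\<psi> (s * piece k (ray_point k)) \<in> f ` (c k \<inter> cball v r)"
      unfolding f_crease[OF that(1)] s_def piece_scale[symmetric]
      by (intro imageI scaled_ray_point r_pos)
    moreover have "\<psi> (s * piece k (ray_point k)) \<in> interior (f ` sec i)"
      unfolding f_sec[OF that(2)] rigid_interior[OF psi] s_def that(4)[symmetric]
      by (intro imageI interior_folded_sector r_pos that(3,5))
    ultimately show ?thesis by blast
  qed
  have in_sectors: "sec k \<in> sectors E v r" if "k < 4" for k
    using that by (simp add: sectors_eq)
  note small = order_trans[OF cmod_le]
  have nb: "\<not> between_layers L (sec 2) (sec 1) (sec 0)"
    by (rule cross[OF adj(5) in_sectors], simp, rule meets[where q = "Complex (1/2) (1/2)"])
      (auto simp: open_wedge_def piece_def ray_point_def complex_eq_iff intro!: small)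
  moreover have "\<not> between_layers L (sec 2) (sec 1) (sec 3)"
    by (rule cross[OF adj(5) in_sectors], simp, rule meets[where q = "Complex (1/2) (-1/2)"])
      (auto simp: open_wedge_def piece_def ray_point_def complex_eq_iff intro!: small)
  moreover have "\<not> between_layers L (sec 3) (sec 2) (sec 0)"
    by (rule cross[OF adj(7) in_sectors], simp, rule meets[where q = "Complex 0 1"])
      (auto simp: open_wedge_def piece_def ray_point_def complex_eq_iff intro!: small)
  moreover have "\<not> between_layers L (sec 3) (sec 2) (sec 1)"
    by (rule cross[OF adj(7) in_sectors], simp, rule meets[where q = "Complex (-1) 0"])
      (auto simp: open_wedge_def piece_def ray_point_def complex_eq_iff intro!: small)
  moreover have "inj_on sec {..<4}"
    by (auto simp: inj_on_def sec_inj)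
  ultimately have order: "(sec 0, sec 1) \<in> L \<longleftrightarrow> (sec 0, sec 3) \<in> L"
    "(sec 2, sec 1) \<in> L \<longleftrightarrow> (sec 3, sec 2) \<in> L"
    "\<And>i k. i < 4 \<Longrightarrow> k < 4 \<Longrightarrow> i \<noteq> k \<Longrightarrow> (sec i, sec k) \<in> L \<longleftrightarrow> (sec k, sec i) \<notin> L"
    using layer_order[OF lin] by blast+
  have asym: "(sec 1, sec 0) \<in> L \<longleftrightarrow> (sec 0, sec 1) \<notin> L" "(sec 3, sec 0) \<in> L \<longleftrightarrow> (sec 0, sec 3) \<notin> L"
    "(sec 2, sec 1) \<in> L \<longleftrightarrow> (sec 1, sec 2) \<notin> L" "(sec 3, sec 2) \<in> L \<longleftrightarrow> (sec 2, sec 3) \<notin> L"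
    by (rule order(3); simp)+
  have vals: "\<mu> (c 0) = - 1 \<or> \<mu> (c 0) = 1" "\<mu> (c 1) = - 1 \<or> \<mu> (c 1) = 1"
    "\<mu> (c 2) = - 1 \<or> \<mu> (c 2) = 1" "\<mu> (c 3) = - 1 \<or> \<mu> (c 3) = 1"
    by (rule mu_pm1; simp)+
  from pattern show ?thesis
  proof
    assume *: "direct_isometry_on (sec 0) f \<and> opposite_isometry_on (sec 1) f \<and>
        direct_isometry_on (sec 2) f \<and> opposite_isometry_on (sec 3) f"
    show ?thesis
      using mv[OF adj(1)] mv[OF adj(4)] mv[OF adj(5)] mv[OF adj(8)] * vals order(1,2) asym
      by auto
  next
    assume *: "opposite_isometry_on (sec 0) f \<and> direct_isometry_on (sec 1) f \<and>
        opposite_isometry_on (sec 2) f \<and> direct_isometry_on (sec 3) f"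
    show ?thesis
      using mv[OF adj(2)] mv[OF adj(3)] mv[OF adj(6)] mv[OF adj(7)] * vals order(1,2) asym
      by auto
  qed
qed

end

section \<open>Sufficiency of the conditions at a corner\<close>

text \<open>
  The pieces agree on the shared rays, so the order of the tests is irrelevant.
\<close>
definition vertex_fold :: "complex \<Rightarrow> complex" where
  "vertex_fold z =
     (if z \<in> wedge 0 then piece 0 z else if z \<in> wedge 1 then piece 1 z
      else if z \<in> wedge 2 then piece 2 z else piece 3 z)"

lemma vertex_fold: "k < 4 \<Longrightarrow> z \<in> wedge k \<Longrightarrow> vertex_fold z = piece k z"
  by (elim less_4_cases) (auto simp: vertex_fold_def wedge_def piece_def complex_eq_iff)

lemma continuous_vertex_fold: "continuous_on S vertex_fold"
proof -
  have "continuous_on (\<Union>k\<in>{..<4}. wedge k) vertex_fold"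
  proof (rule continuous_on_closed_Union)
    fix k :: nat assume "k \<in> {..<4}"
    then have "continuous_on (wedge k) vertex_fold \<longleftrightarrow> continuous_on (wedge k) (piece k)"
      by (intro continuous_on_cong) (simp_all add: vertex_fold)
    then show "continuous_on (wedge k) vertex_fold"
      using rigid_continuous[OF rigid_piece] by simp
  qed (simp_all add: closed_wedge)
  then show ?thesis
    unfolding UN_wedge by (rule continuous_on_subset) simp
qed

lemma isometry_on_mono:
  "direct_isometry_on UNIV f \<Longrightarrow> direct_isometry_on S f"
  "opposite_isometry_on UNIV f \<Longrightarrow> opposite_isometry_on S f"
  unfolding direct_isometry_on_def opposite_isometry_on_def by blast+

lemma isometry_on_cong:
  assumes "\<And>z. z \<in> S \<Longrightarrow> f z = g z"
  shows "direct_isometry_on S f \<longleftrightarrow> direct_isometry_on S g"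
    and "opposite_isometry_on S f \<longleftrightarrow> opposite_isometry_on S g"
  unfolding direct_isometry_on_def opposite_isometry_on_def by (simp_all add: assms cong: ball_cong)

text \<open>
  Conjugating by a rigid motion keeps the orientation: a reversal enters twice or not at all.
\<close>
lemma conjugate_orientation:
  assumes "rigid h"
  shows "direct_isometry_on UNIV g \<Longrightarrow> direct_isometry_on S (h \<circ> (g \<circ> inv h))"
    and "opposite_isometry_on UNIV g \<Longrightarrow> opposite_isometry_on S (h \<circ> (g \<circ> inv h))"
proof -
  show "direct_isometry_on S (h \<circ> (g \<circ> inv h))" if "direct_isometry_on UNIV g"
    using assms unfolding rigid_def
  proof
    assume h: "direct_isometry_on UNIV h"
    show ?thesis
      by (rule isometry_on_mono(1), rule orientation_post(1)[OF h],
          rule orientation_post(1)[OF that], rule orientation_inv(1)[OF h])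
  next
    assume h: "opposite_isometry_on UNIV h"
    show ?thesis
      by (rule isometry_on_mono(1), rule orientation_post(4)[OF h],
          rule orientation_post(2)[OF that], rule orientation_inv(2)[OF h])
  qed
  show "opposite_isometry_on S (h \<circ> (g \<circ> inv h))" if "opposite_isometry_on UNIV g"
    using assms unfolding rigid_def
  proof
    assume h: "direct_isometry_on UNIV h"
    show ?thesis
      by (rule isometry_on_mono(2), rule orientation_post(2)[OF h],
          rule orientation_post(3)[OF that], rule orientation_inv(1)[OF h])
  next
    assume h: "opposite_isometry_on UNIV h"
    show ?thesis
      by (rule isometry_on_mono(2), rule orientation_post(3)[OF h],
          rule orientation_post(4)[OF that], rule orientation_inv(2)[OF h])
  qed
qed

lemma sector_orientation_exclusive:
  assumes "r > 0" "k < 4" "direct_isometry_on (sector r k) h" "opposite_isometry_on (sector r k) h"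
  shows False
proof -
  define s where "s = complex_of_real (r / 2)"
  have "s * ray_point k \<in> sector r k"
    using scaled_ray_point[OF assms(1), of k] ray_subset_wedge[OF assms(2)]
    unfolding s_def sector_def by blast
  moreover have "s * wedge_point k \<in> sector r k"
    using scaled_wedge_point[OF assms(1), of k] open_wedge_subset_wedge ball_subset_cball
    unfolding s_def sector_def by blast
  moreover have "0 \<in> sector r k"
    using assms(1) by (auto simp: sector_def wedge_def)
  ultimately have "Im (s * ray_point k * cnj (s * wedge_point k)) = 0"
    by (intro orientation_exclusive[OF assms(3,4), of 0]) (simp_all only: add_0)
  also have "s * ray_point k * cnj (s * wedge_point k) =
      of_real (r / 2 * (r / 2)) * (ray_point k * cnj (wedge_point k))"
    unfolding s_def by simp
  finally have "r / 2 * (r / 2) * Im (ray_point k * cnj (wedge_point k)) = 0"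
    by (simp only: Im_complex_of_real Re_complex_of_real times_complex.simps)
  then have "Im (ray_point k * cnj (wedge_point k)) = 0"
    using assms(1) by simp
  then show False
    using assms(2) by (elim less_4_cases) (auto simp: ray_point_def wedge_point_def)
qed

lemma interior_subset_halfspace:
  fixes p :: complex
  assumes "p \<noteq> 0" "\<And>z. z \<in> S \<Longrightarrow> 0 \<le> p \<bullet> z" "z \<in> interior S"
  shows "0 < p \<bullet> z"
proof -
  have "interior S \<subseteq> interior {z. p \<bullet> z \<ge> 0}"
    using assms(2) by (intro interior_mono) auto
  then show ?thesis
    using assms(1,3) by (auto simp: interior_halfspace_ge)
qed

text \<open>
  The pairs are those for which some admissible layer order puts sector \<open>i\<close> between the two sectors
  at ray \<open>k\<close>. In each case a line through the origin separates the image of the ray from the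
  interior of the image of the sector.
\<close>
lemma folded_ray_avoids_sector:
  assumes "k = 0 \<and> i = 1 \<or> k = 0 \<and> i = 2 \<or> k = 1 \<and> i = 2 \<or> k = 1 \<and> i = 3"
  shows "piece k ` ray k \<inter> interior (piece i ` sector r i) = {}"
proof -
  \<comment> \<open>normal vector of the separating line\<close>
  define p where "p = (if k = 0 then Complex (-1) 1 else Complex 1 0)"
  have "p \<noteq> 0" by (simp add: p_def complex_eq_iff)
  moreover have "0 \<le> p \<bullet> z" if "z \<in> piece i ` sector r i" for z
    using that assms by (auto simp: p_def sector_def wedge_def piece_def inner_complex_def)
  moreover have "p \<bullet> z \<le> 0" if "z \<in> piece k ` ray k" for z
    using that assms by (auto simp: p_def ray_def piece_def inner_complex_def)
  ultimately have "\<not> z \<in> piece k ` ray k" if "z \<in> interior (piece i ` sector r i)" for z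
    using interior_subset_halfspace[of p "piece i ` sector r i" z] that by (meson not_le)
  then show ?thesis by blast
qed

lemma fold_lines_meet_in_0:
  "i < 4 \<Longrightarrow> k < 4 \<Longrightarrow> i \<noteq> k \<Longrightarrow> z \<in> fold_line i \<Longrightarrow> z \<in> fold_line k \<Longrightarrow> z = 0"
  by (elim less_4_cases) (auto simp: fold_line_def complex_eq_iff)

lemma strict_linear_order_of_rank:
  fixes A :: "nat \<Rightarrow> 's" and rank :: "nat \<Rightarrow> int"
  assumes A: "inj_on A {..<n}" and rank: "inj_on rank {..<n}" and B: "B \<subseteq> A ` {..<n}"
  shows "strict_linear_order_on B
    ({(A i, A j) | i j. i < n \<and> j < n \<and> rank i < rank j} \<inter> B \<times> B)"
proof -
  define L where "L = {(A i, A j) | i j. i < n \<and> j < n \<and> rank i < rank j}"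
  have L: "(A i, A j) \<in> L \<longleftrightarrow> rank i < rank j" if "i < n" "j < n" for i j
    using that A unfolding L_def inj_on_def by blast
  have ex: "\<exists>i<n. x = A i" if "x \<in> B" for x
    using that B by blast
  have "trans (L \<inter> B \<times> B)"
  proof (rule transI)
    fix x y z assume *: "(x, y) \<in> L \<inter> B \<times> B" "(y, z) \<in> L \<inter> B \<times> B"
    then have xyz: "x \<in> B" "y \<in> B" "z \<in> B" by simp_all
    obtain i where i: "i < n" "x = A i" using ex[OF xyz(1)] by blast
    obtain j where j: "j < n" "y = A j" using ex[OF xyz(2)] by blast
    obtain k where k: "k < n" "z = A k" using ex[OF xyz(3)] by blast
    from * i j k show "(x, z) \<in> L \<inter> B \<times> B"
      by (simp add: L)
  qed
  moreover have "irrefl (L \<inter> B \<times> B)"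
    unfolding irrefl_def using ex L by auto
  moreover have "total_on B (L \<inter> B \<times> B)"
  proof (rule total_onI)
    fix x y assume *: "x \<in> B" "y \<in> B" "x \<noteq> y"
    obtain i where i: "i < n" "x = A i" using ex[OF *(1)] by blast
    obtain j where j: "j < n" "y = A j" using ex[OF *(2)] by blast
    note ij = i j
    then have "rank i \<noteq> rank j"
      using * rank unfolding inj_on_def by blast
    then have "rank i < rank j \<or> rank j < rank i" by linarith
    then show "(x, y) \<in> L \<inter> B \<times> B \<or> (y, x) \<in> L \<inter> B \<times> B"
      using * L ij by auto
  qed
  ultimately show ?thesis
    unfolding strict_linear_order_on_def L_def by blast
qed

context twist_vertex
begin

text \<open>
  The witness is the model folding with the layers ordered by an integer rank: sectors \<open>1\<close>, \<open>2\<close>,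
  \<open>3\<close> are consecutive, in the order that crease \<open>3\<close> asks for, and sector \<open>0\<close> is outside, on the
  side that crease \<open>0\<close> asks for.
\<close>
lemma folds_flat_if_crease_conditions:
  assumes m01: "\<mu> (c 0) = \<mu> (c 1)" and m23: "\<mu> (c 2) = - \<mu> (c 3)"
    and m0: "\<mu> (c 0) = - 1 \<or> \<mu> (c 0) = 1" and m3: "\<mu> (c 3) = - 1 \<or> \<mu> (c 3) = 1"
  shows "disk_folds_flat E \<mu> v r"
proof -
  define f where "f = \<phi> \<circ> vertex_fold \<circ> inv \<phi>"
  have f: "f (\<phi> z) = \<phi> (piece k z)" if "k < 4" "z \<in> wedge k" for k z
    using that by (simp add: f_def inv_f_f[OF rigid_inj[OF rigid_phi]] vertex_fold)
  have f_sec: "f ` sec k = \<phi> ` piece k ` sector r k" if "k < 4" for k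
    unfolding image_image by (rule image_cong) (auto simp: f[OF that] sector_def)
  have f_crease: "f ` (c k \<inter> cball v r) = \<phi> ` piece k ` (ray k \<inter> cball 0 r)" if "k < 4" for k
    unfolding crease_ray[OF that] image_image using ray_subset_wedge[OF that]
    by (intro image_cong) (auto simp: f[OF that])
  have f_cong: "f z = (\<phi> \<circ> (piece k \<circ> inv \<phi>)) z" if "k < 4" "z \<in> sec k" for k z
    using that by (auto simp: f sector_def inv_f_f[OF rigid_inj[OF rigid_phi]])
  have exclusive: "\<not> (direct_isometry_on (sec k) f \<and> opposite_isometry_on (sec k) f)"
    if "k < 4" for k
    using rigid_phi unfolding rigid_def
    by (elim disjE) (use sector_orientation_exclusive[OF r_pos that, of "f \<circ> \<phi>"]
        orientation_comp[of \<phi> "sector r k" f] in blast)+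
  have direct: "direct_isometry_on (sec k) f"
    if "k < 4" "direct_isometry_on UNIV (piece k)" for k
    using conjugate_orientation(1)[OF rigid_phi that(2), of "sec k"]
      isometry_on_cong(1)[of "sec k" f "\<phi> \<circ> (piece k \<circ> inv \<phi>)", OF f_cong[OF that(1)]] by blast
  have opposite: "opposite_isometry_on (sec k) f"
    if "k < 4" "opposite_isometry_on UNIV (piece k)" for k
    using conjugate_orientation(2)[OF rigid_phi that(2), of "sec k"]
      isometry_on_cong(2)[of "sec k" f "\<phi> \<circ> (piece k \<circ> inv \<phi>)", OF f_cong[OF that(1)]] by blast
  have "direct_isometry_on (sec 0) f" "opposite_isometry_on (sec 1) f"
    "direct_isometry_on (sec 2) f" "opposite_isometry_on (sec 3) f"
    by (rule direct opposite, simp, rule piece_orientation)+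
  then have dir: "direct_isometry_on (sec k) f \<longleftrightarrow> even k"
    and opp: "opposite_isometry_on (sec k) f \<longleftrightarrow> odd k" if "k < 4" for k
    using that exclusive[of 0] exclusive[of 1] exclusive[of 2] exclusive[of 3]
    by (elim less_4_cases; simp)+

  \<comment> \<open>the factor 2 keeps sector \<open>0\<close> outside the values \<open>- 1\<close>, \<open>0\<close>, \<open>1\<close> of the others\<close>
  define rank :: "nat \<Rightarrow> int" where
    "rank k = (if k = 0 then 2 * \<mu> (c 0) else if k = 1 then \<mu> (c 3)
      else if k = 2 then 0 else - \<mu> (c 3))" for k
  define L where "L = {(sec i, sec j) | i j. i < 4 \<and> j < 4 \<and> rank i < rank j}"
  have L_iff: "(sec i, sec j) \<in> L \<longleftrightarrow> rank i < rank j" if "i < 4" "j < 4" for i j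
    using that by (auto simp: L_def sec_inj)
  have rank_inj: "i = j" if "i < 4" "j < 4" "rank i = rank j" for i j
    using that m0 m3 by (elim less_4_cases) (auto simp: rank_def)
  have "inj_on sec {..<4}"
    by (auto simp: inj_on_def sec_inj)
  then have lin: "strict_linear_order_on B (L \<inter> B \<times> B)" if "B \<subseteq> sec ` {..<4}" for B
    unfolding L_def by (rule strict_linear_order_of_rank) (use that rank_inj in \<open>auto simp: inj_on_def\<close>)

  have crease_orders: "(\<mu> (c k) = - 1 \<longrightarrow> rank i < rank j) \<and> (\<mu> (c k) = 1 \<longrightarrow> rank j < rank i)"
    if "k < 4" "even i" "odd j" "i = k \<and> j = (k + 3) mod 4 \<or> i = (k + 3) mod 4 \<and> j = k" for i j k
    using that m01 m23 m0 m3 by (elim less_4_cases) (auto simp: rank_def)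
  \<comment> \<open>the only sectors that lie between the two sectors at a crease; the image of the crease avoids them\<close>
  have crossings: "k = 0 \<and> i = 1 \<or> k = 0 \<and> i = 2 \<or> k = 1 \<and> i = 2 \<or> k = 1 \<and> i = 3"
    if "k < 4" "i < 4" "between_layers L (sec k) (sec ((k + 3) mod 4)) (sec i)" for i k
    using that(3) L_iff that(1,2) m0 m3 unfolding between_layers_def
    by (elim less_4_cases) (auto simp: rank_def)
  have between_sym: "between_layers L P Q R \<longleftrightarrow> between_layers L Q P R" for P Q R
    by (auto simp: between_layers_def)

  have cont: "continuous_on (cball v r) f"
    unfolding f_def by (intro continuous_on_compose rigid_continuous rigid_phi rigid_inv
        continuous_vertex_fold)
  have iso: "direct_isometry_on S f \<or> opposite_isometry_on S f" if "S \<in> sectors E v r" for S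
    using that dir opp unfolding sectors_eq by auto
  have alt: "direct_isometry_on P f \<longleftrightarrow> opposite_isometry_on Q f"
    if adj: "adjacent_sectors E v r e P Q" for e P Q
  proof -
    obtain k where k: "k < 4"
      and PQ: "P = sec k \<and> Q = sec ((k + 3) mod 4) \<or> P = sec ((k + 3) mod 4) \<and> Q = sec k"
      using adj unfolding adjacent_iff by blast
    have "odd ((k + 3) mod 4) \<longleftrightarrow> even k" "(k + 3) mod 4 < 4"
      using k by (elim less_4_cases; simp)+
    then show ?thesis
      using PQ k by (auto simp: dir opp)
  qed
  have stack: "strict_linear_order_on {S \<in> sectors E v r. p \<in> f ` S}
      (L \<inter> {S \<in> sectors E v r. p \<in> f ` S} \<times> {S \<in> sectors E v r. p \<in> f ` S})" for p
    by (rule lin) (auto simp: sectors_eq)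
  have mv: "(\<mu> e = - 1 \<longrightarrow> (P, Q) \<in> L) \<and> (\<mu> e = 1 \<longrightarrow> (Q, P) \<in> L)"
    if adj: "adjacent_sectors E v r e P Q"
      and "direct_isometry_on P f" "opposite_isometry_on Q f" for e P Q
  proof -
    obtain k where k: "k < 4" "e = c k"
      and PQ: "P = sec k \<and> Q = sec ((k + 3) mod 4) \<or> P = sec ((k + 3) mod 4) \<and> Q = sec k"
      using adj unfolding adjacent_iff by blast
    have k3: "(k + 3) mod 4 < 4" by simp
    from PQ show ?thesis
    proof (elim disjE conjE)
      assume PQ: "P = sec k" "Q = sec ((k + 3) mod 4)"
      show ?thesis
        using crease_orders[OF k(1), of k "(k + 3) mod 4"] that(2,3) k3 k(1)
        unfolding PQ k(2) by (simp only: dir opp L_iff) blast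
    next
      assume PQ: "P = sec ((k + 3) mod 4)" "Q = sec k"
      show ?thesis
        using crease_orders[OF k(1), of "(k + 3) mod 4" k] that(2,3) k3 k(1)
        unfolding PQ k(2) by (simp only: dir opp L_iff) blast
    qed
  qed
  have cross: "\<not> between_layers L P Q R"
    if adj: "adjacent_sectors E v r e P Q" and R: "R \<in> sectors E v r"
      and meet: "f ` (e \<inter> cball v r) \<inter> interior (f ` R) \<noteq> {}" for e P Q R
  proof
    assume btw: "between_layers L P Q R"
    obtain i where i: "i < 4" "R = sec i"
      using R unfolding sectors_eq by auto
    obtain k where k: "k < 4" "e = c k"
      and PQ: "P = sec k \<and> Q = sec ((k + 3) mod 4) \<or> P = sec ((k + 3) mod 4) \<and> Q = sec k"
      using adj unfolding adjacent_iff by blast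
    have "between_layers L (sec k) (sec ((k + 3) mod 4)) (sec i)"
      using btw PQ between_sym i(2) by auto
    then have "piece k ` ray k \<inter> interior (piece i ` sector r i) = {}"
      using crossings k(1) i(1) folded_ray_avoids_sector by blast
    then have "\<phi> ` (piece k ` (ray k \<inter> cball 0 r)) \<inter> \<phi> ` interior (piece i ` sector r i) = {}"
      by (auto simp: rigid_eq_iff[OF rigid_phi])
    then show False
      using meet unfolding k(2) i(2) f_crease[OF k(1)] f_sec[OF i(1)] rigid_interior[OF rigid_phi]
      by blast
  qed
  have distinct_images: False
    if "e \<noteq> d" and adj: "adjacent_sectors E v r e P Q" "adjacent_sectors E v r d R T"
      and same: "f ` (e \<inter> cball v r) = f ` (d \<inter> cball v r)" for e d P Q R T
  proof -
    obtain i k where ik: "i < 4" "k < 4" "e = c i" "d = c k"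
      using adj unfolding adjacent_iff by blast
    with \<open>e \<noteq> d\<close> have "i \<noteq> k" by auto
    \<comment> \<open>a point of one image that the other image does not contain\<close>
    define w where "w = piece i (of_real (r / 2) * ray_point i)"
    have "\<phi> w \<in> f ` (c i \<inter> cball v r)"
      unfolding f_crease[OF ik(1)] w_def by (intro imageI scaled_ray_point r_pos)
    then have "\<phi> w \<in> \<phi> ` piece k ` (ray k \<inter> cball 0 r)"
      using same unfolding ik f_crease[OF ik(2)] by simp
    then have "w \<in> piece k ` ray k"
      by (auto simp: rigid_eq_iff[OF rigid_phi])
    then have "w \<in> fold_line k"
      using piece_ray[OF ik(2)] by (elim imageE) simp
    moreover have "w \<in> fold_line i"
      unfolding w_def using scaled_ray_point[OF r_pos, of i] by (intro piece_ray ik(1)) simp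
    ultimately have "w = 0"
      by (intro fold_lines_meet_in_0[OF ik(1,2) \<open>i \<noteq> k\<close>])
    then have "piece i (ray_point i) = 0"
      unfolding w_def piece_scale using r_pos by simp
    then show False
      using ik(1) by (elim less_4_cases) (simp_all add: piece_def ray_point_def complex_eq_iff)
  qed
  show ?thesis
    unfolding disk_folds_flat_def Let_def
    apply (intro exI[of _ f] exI[of _ L] conjI)
    subgoal by (rule cont)
    subgoal by (intro ballI iso)
    subgoal by (intro allI impI alt)
    subgoal by (intro allI impI stack)
    subgoal by (intro allI impI, elim conjE, rule mv)
    subgoal by (intro allI impI, elim conjE, rule cross)
    subgoal by (intro allI impI, elim conjE, rule FalseE, rule distinct_images)
    done
qed

text \<open>
  The Maekawa and big-little-big conditions for a corner with the angles \<open>135\<close>, \<open>90\<close>, \<open>45\<close>, \<open>90\<close>: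
  equal values on the sides of the largest sector, opposite values on those of the smallest one.
\<close>
lemma disk_folds_flat_iff:
  assumes "\<And>k. k < 4 \<Longrightarrow> \<mu> (c k) = - 1 \<or> \<mu> (c k) = 1"
  shows "disk_folds_flat E \<mu> v r \<longleftrightarrow> \<mu> (c 0) = \<mu> (c 1) \<and> \<mu> (c 2) = - \<mu> (c 3)"
proof
  show "disk_folds_flat E \<mu> v r \<Longrightarrow> \<mu> (c 0) = \<mu> (c 1) \<and> \<mu> (c 2) = - \<mu> (c 3)"
    by (rule crease_conditions_if_folds_flat) (use assms in auto)
  show "\<mu> (c 0) = \<mu> (c 1) \<and> \<mu> (c 2) = - \<mu> (c 3) \<Longrightarrow> disk_folds_flat E \<mu> v r"
    by (rule folds_flat_if_crease_conditions) (use assms[of 0] assms[of 3] in auto)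
qed

end

section \<open>Coordinates of the mirrored cells\<close>

definition mirror_coord :: "real \<Rightarrow> nat \<Rightarrow> real \<Rightarrow> real" where
  "mirror_coord l j x = 2 * l * real j + (- 1) ^ j * x"

lemma place_cell_mirror_coord: "place_cell l i j z = Complex (mirror_coord l j (Re z)) (mirror_coord l i (Im z))"
  by (simp add: place_cell_def mirror_coord_def)

text \<open>
  The grid lines perpendicular to one axis are numbered from \<open>0\<close>; cell \<open>j\<close> lies between the lines
  \<open>j\<close> and \<open>j + 1\<close>. The edge of cell \<open>j\<close> with local coordinate \<open>l\<close> (for \<open>s\<close>) or \<open>- l\<close> (for \<open>\<not> s\<close>) is
  on line \<open>seam s j\<close>; which of the two lines it is alternates because of the mirror images.
\<close>
definition seam :: "bool \<Rightarrow> nat \<Rightarrow> nat" where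
  "seam s j = (if even j = s then j + 1 else j)"

lemma mirror_coord_meet_less:
  assumes "0 < l" "\<bar>x\<bar> \<le> l" "\<bar>x'\<bar> \<le> l" "mirror_coord l j x = mirror_coord l j' x'" "j < j'"
  shows "j' = j + 1 \<and> x = x' \<and> x = (if even j then l else - l)"
proof -
  have abs: "\<bar>(- 1) ^ j * x\<bar> \<le> l" "\<bar>(- 1) ^ j' * x'\<bar> \<le> l"
    using assms(2,3) by (simp_all add: abs_mult)
  have "2 * l * (real j' - real j) = (- 1) ^ j * x - (- 1) ^ j' * x'"
    using assms(4) by (simp add: mirror_coord_def algebra_simps)
  also have "\<dots> \<le> 2 * l * 1"
    using abs by linarith
  finally have "real j' - real j \<le> 1"
    by (rule mult_left_le_imp_le) (use assms(1) in simp)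
  then have j': "j' = j + 1"
    using assms(5) by linarith
  have "(- 1) ^ j * x + (- 1) ^ j * x' = 2 * l"
    using assms(4) by (simp add: mirror_coord_def j' algebra_simps)
  then show ?thesis
    using j' assms(2,3) by (cases "even j") auto
qed

text \<open>
  The mirrored cells fold back onto a single cell: a point in two cells has the same local
  coordinate in both, and the cells are then equal or share the line through the point.
\<close>
lemma mirror_coord_meet:
  assumes "0 < l" "\<bar>x\<bar> \<le> l" "\<bar>x'\<bar> \<le> l" "mirror_coord l j x = mirror_coord l j' x'"
  shows "x = x' \<and> (j = j' \<or> x = l \<and> seam True j = seam True j' \<or> x = - l \<and> seam False j = seam False j')"
proof (cases j j' rule: linorder_cases)
  case less
  then show ?thesis
    using mirror_coord_meet_less[OF assms] by (auto simp: seam_def split: if_splits)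
next
  case equal
  then show ?thesis
    using assms(4) by (simp add: mirror_coord_def)
next
  case greater
  then show ?thesis
    using mirror_coord_meet_less[OF assms(1,3,2) assms(4)[symmetric]] by (auto simp: seam_def split: if_splits)
qed

lemma mirror_coord_border: "mirror_coord l j (if s then l else - l) = l * (2 * real (seam s j) - 1)"
  by (cases "even j"; cases s) (auto simp: mirror_coord_def seam_def algebra_simps)

lemma mirror_coord_border_eq_iff:
  "0 < l \<Longrightarrow> mirror_coord l j (if s then l else - l) = mirror_coord l j' (if s then l else - l) \<longleftrightarrow> seam s j = seam s j'"
  unfolding mirror_coord_border by simp

lemma seam_fiber: "seam s j' = seam s j \<Longrightarrow> j' \<noteq> j \<Longrightarrow> j' = (if even j = s then j + 1 else j - 1)"
  by (auto simp: seam_def split: if_splits)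

lemma mirror_coord_reflect:
  assumes "seam s j' = seam s j" "j' \<noteq> j"
  shows "mirror_coord l j' x = mirror_coord l j ((if s then 2 * l else - 2 * l) - x)"
  using assms by (cases "even j"; cases s) (auto simp: seam_def mirror_coord_def algebra_simps split: if_splits)

text \<open>
  The cell on the other side of line \<open>seam s j\<close> has the same local edge there, so it is missing only
  at the two ends of the row.
\<close>
lemma seam_partner:
  assumes "j < n" "\<And>j'. j' < n \<Longrightarrow> seam s j' = seam s j \<Longrightarrow> j' = j"
  shows "seam s j = 0 \<or> seam s j = n"
proof (rule ccontr)
  assume no: "\<not> ?thesis"
  define j' where "j' = (if even j = s then j + 1 else j - 1)"
  have "j' < n" "seam s j' = seam s j" "j' \<noteq> j"
    using no assms(1) by (auto simp: j'_def seam_def split: if_splits)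
  then show False
    using assms(2) by blast
qed

lemma seam_le: "j < n \<Longrightarrow> seam s j \<le> n"
  by (simp add: seam_def)

text \<open>
  The line determines the local edge: right edges are on odd lines and left edges on even ones.
\<close>
lemma seam_parity: "even (seam s j) \<longleftrightarrow> \<not> s"
  by (auto simp: seam_def)

lemma seam_surj: "1 \<le> n \<Longrightarrow> k \<le> n \<Longrightarrow> \<exists>j<n. seam (odd k) j = k"
proof (cases "k < n")
  case False
  assume "1 \<le> n" "k \<le> n"
  with False show ?thesis
    by (intro exI[of _ "n - 1"]) (auto simp: seam_def)
qed (auto simp: seam_def)

section \<open>The single twist\<close>

text \<open>
  The single twist is invariant under quarter turns, so everything is described for \<open>q = 0\<close> and
  turned \<open>q\<close> times.
\<close>
definition turned :: "nat \<Rightarrow> real \<Rightarrow> real \<Rightarrow> complex" where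
  "turned q x y = \<i> ^ q * Complex x y"

lemma turned_simps:
  "turned 0 x y = Complex x y" "turned (Suc 0) x y = Complex (- y) x"
  "turned 2 x y = Complex (- x) (- y)" "turned 3 x y = Complex y (- x)" "turned 4 x y = Complex x y"
  "turned (Suc (Suc 0)) x y = Complex (- x) (- y)" "turned (Suc (Suc (Suc 0))) x y = Complex y (- x)"
  by (simp_all add: turned_def complex_eq_iff power_numeral_reduce)

definition corner :: "real \<Rightarrow> nat \<Rightarrow> complex" where
  "corner a q = turned q a 0"

definition side :: "real \<Rightarrow> nat \<Rightarrow> complex set" where
  "side a q = closed_segment (corner a q) (corner a (q + 1))"

text \<open>
  The pleat in direction \<open>\<i> ^ q\<close> starts from the side \<open>q\<close>; its crease \<open>b = False\<close> leaves from the
  corner \<open>q\<close> and the crease \<open>b = True\<close> from the corner \<open>q + 1\<close>.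
\<close>
definition pleat :: "real \<Rightarrow> real \<Rightarrow> nat \<Rightarrow> bool \<Rightarrow> complex set" where
  "pleat a l q b = closed_segment (turned q (if b then 0 else a) (if b then a else 0))
     (turned q l (if b then a else 0))"

lemma twist_corners_eq: "twist_corners a = corner a ` {..<4}"
proof -
  have "{..<4::nat} = {0, Suc 0, 2, 3}" by auto
  then show ?thesis
    by (simp add: twist_corners_def corner_def turned_simps)
qed

lemma twist_sides_eq: "twist_sides a = side a ` {..<4}"
proof -
  have "{..<4::nat} = {0, Suc 0, 2, 3}" by auto
  then show ?thesis
    by (simp add: twist_sides_def side_def corner_def turned_simps)
qed

lemma twist_pleats_eq: "twist_pleats a l = (\<lambda>(q, b). pleat a l q b) ` ({..<4} \<times> UNIV)"
proof -
  have "{..<4::nat} \<times> (UNIV :: bool set) = {(0, False), (0, True), (Suc 0, False), (Suc 0, True),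
      (2, False), (2, True), (3, False), (3, True)}"
    by (auto simp: UNIV_bool)
  then show ?thesis
    by (simp add: twist_pleats_def pleat_def turned_simps)
qed

lemma mem_horizontal: "z \<in> closed_segment (Complex x y) (Complex x' y) \<longleftrightarrow>
    Im z = y \<and> Re z \<in> closed_segment x x'"
  by (subst closed_segment_same_Im) auto

lemma mem_vertical: "z \<in> closed_segment (Complex x y) (Complex x y') \<longleftrightarrow>
    Re z = x \<and> Im z \<in> closed_segment y y'"
  by (subst closed_segment_same_Re) auto

lemma mem_pleat:
  assumes "q < 4" "0 < a" "a < l"
  shows "z \<in> pleat a l q b \<longleftrightarrow> (\<exists>x. (if b then 0 else a) \<le> x \<and> x \<le> l \<and> z = turned q x (if b then a else 0))"
  using assms(1)
  by (elim less_4_cases)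
    (use assms(2,3) in \<open>auto simp: pleat_def turned_simps mem_horizontal mem_vertical
      closed_segment_eq_real_ivl complex_eq_iff intro: exI[of _ "Re z"] exI[of _ "Im z"]
      exI[of _ "- Re z"] exI[of _ "- Im z"]\<close>)

lemma pleats_meet_at_corner:
  assumes "q < 4" "q' < 4" "0 < a" "a < l" "z \<in> pleat a l q b" "z \<in> pleat a l q' b'"
    and "(q, b) \<noteq> (q', b')"
  shows "z \<in> twist_corners a"
proof -
  obtain x where x: "(if b then 0 else a) \<le> x" "x \<le> l" "z = turned q x (if b then a else 0)"
    using assms(5) mem_pleat[OF assms(1,3,4)] by blast
  obtain x' where x': "(if b' then 0 else a) \<le> x'" "x' \<le> l" "z = turned q' x' (if b' then a else 0)"
    using assms(6) mem_pleat[OF assms(2,3,4)] by blast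
  have "turned q x (if b then a else 0) = turned q' x' (if b' then a else 0)"
    using x(3) x'(3) by simp
  then show ?thesis
    unfolding x(3) using assms(1,2,7) x(1,2) x'(1,2) assms(3,4)
    by (elim less_4_cases) (auto simp: turned_simps twist_corners_def split: if_splits)
qed

lemma corner_mem_pleat:
  assumes "p < 4" "q < 4" "0 < a" "a < l"
  shows "corner a p \<in> pleat a l q b \<longleftrightarrow> p = (if b then (q + 1) mod 4 else q)"
  using assms(1,2) unfolding mem_pleat[OF assms(2-4)]
  by (elim less_4_cases) (use assms(3,4) in \<open>auto simp: corner_def turned_simps\<close>)

lemma corner_mem_side:
  assumes "p < 4" "q < 4" "0 < a"
  shows "corner a p \<in> side a q \<longleftrightarrow> p = q \<or> p = (q + 1) mod 4"
proof
  assume "corner a p \<in> side a q"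
  then obtain u where "corner a p = (1 - u) *\<^sub>R corner a q + u *\<^sub>R corner a (q + 1)"
    unfolding side_def in_segment by blast
  then show "p = q \<or> p = (q + 1) mod 4"
    using assms(1,2) by (elim less_4_cases)
      (use assms(3) in \<open>auto simp: corner_def turned_simps complex_eq_iff algebra_simps\<close>)
next
  assume "p = q \<or> p = (q + 1) mod 4"
  moreover have "corner a ((q + 1) mod 4) = corner a (q + 1)"
    using assms(2) by (elim less_4_cases) (auto simp: corner_def turned_simps)
  ultimately show "corner a p \<in> side a q"
    unfolding side_def by auto
qed

lemma corner_inj: "0 < a \<Longrightarrow> p < 4 \<Longrightarrow> q < 4 \<Longrightarrow> corner a p = corner a q \<longleftrightarrow> p = q"
  by (elim less_4_cases) (auto simp: corner_def turned_simps)

lemma side_in_cell: "q < 4 \<Longrightarrow> 0 < a \<Longrightarrow> z \<in> side a q \<Longrightarrow> \<bar>Re z\<bar> \<le> a \<and> \<bar>Im z\<bar> \<le> a"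
proof -
  assume "q < 4" "0 < a" "z \<in> side a q"
  then obtain u where u: "0 \<le> u" "u \<le> 1" "z = (1 - u) *\<^sub>R corner a q + u *\<^sub>R corner a (q + 1)"
    unfolding side_def in_segment by blast
  have "0 \<le> u * a" "u * a \<le> a"
    using u \<open>0 < a\<close> mult_left_le_one_le[of a u] by auto
  then show ?thesis
    using \<open>q < 4\<close> unfolding u(3)
    by (elim less_4_cases) (auto simp: corner_def turned_simps algebra_simps abs_if)
qed

lemma pleat_in_cell:
  assumes "q < 4" "0 < a" "a < l" "z \<in> pleat a l q b"
  shows "\<bar>Re z\<bar> \<le> l \<and> \<bar>Im z\<bar> \<le> l"
proof -
  obtain x where "(if b then 0 else a) \<le> x" "x \<le> l" "z = turned q x (if b then a else 0)"
    using assms(4) mem_pleat[OF assms(1-3)] by blast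
  then show ?thesis
    using assms(1) by (elim less_4_cases) (use assms(2,3) in \<open>auto simp: turned_simps split: if_splits\<close>)
qed

lemma corner_in_cell: "q < 4 \<Longrightarrow> 0 < a \<Longrightarrow> \<bar>Re (corner a q)\<bar> \<le> a \<and> \<bar>Im (corner a q)\<bar> \<le> a"
  by (elim less_4_cases) (auto simp: corner_def turned_simps)

lemma rigid_closed_segment: "rigid h \<Longrightarrow> h ` closed_segment x y = closed_segment (h x) (h y)"
  by (elim rigid_linear_part)
    (simp only: o_apply image_comp[symmetric] closed_segment_translation closed_segment_linear_image)

lemma rigid_place_cell: "rigid (place_cell l i j)"
proof -
  define w where "w = Complex (2 * l * real j) (2 * l * real i)"
  consider "even i" "even j" | "odd i" "odd j" | "odd i" "even j" | "even i" "odd j"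
    by blast
  then show ?thesis
  proof cases
    case 1
    then have "direct_isometry_on UNIV (place_cell l i j)"
      by (intro direct_isometryI[of 1 _ _ w]) (auto simp: place_cell_def w_def complex_eq_iff)
    then show ?thesis by (simp add: rigid_def)
  next
    case 2
    then have "direct_isometry_on UNIV (place_cell l i j)"
      by (intro direct_isometryI[of "- 1" _ _ w]) (auto simp: place_cell_def w_def complex_eq_iff)
    then show ?thesis by (simp add: rigid_def)
  next
    case 3
    then have "opposite_isometry_on UNIV (place_cell l i j)"
      by (intro opposite_isometryI[of 1 _ _ w]) (auto simp: place_cell_def w_def complex_eq_iff)
    then show ?thesis by (simp add: rigid_def)
  next
    case 4
    then have "opposite_isometry_on UNIV (place_cell l i j)"
      by (intro opposite_isometryI[of "- 1" _ _ w]) (auto simp: place_cell_def w_def complex_eq_iff)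
    then show ?thesis by (simp add: rigid_def)
  qed
qed

section \<open>The creases of the tessellation\<close>

locale twist_grid =
  fixes a l :: real and m n :: nat
  assumes a: "0 < a" and al: "a < l"
begin

abbreviation X where "X \<equiv> grid_sheet l m n"
abbreviation V where "V \<equiv> grid_vertices a l m n"
abbreviation E where "E \<equiv> grid_creases a l m n"
abbreviation place where "place \<equiv> place_cell l"

definition grid_vertex where "grid_vertex i j q = place i j (corner a q)"
definition grid_side where "grid_side i j q = place i j ` side a q"
definition cell_pleat where "cell_pleat i j q b = place i j ` pleat a l q b"
definition border where "border i j q b = place i j (turned q l (if b then a else 0))"

text \<open>
  The pleat \<open>q\<close> of a cell runs to a grid line; row (or column) and line identify the pleat of the
  whole tessellation among those with direction \<open>q\<close>.
\<close>
definition pleat_class :: "nat \<Rightarrow> nat \<Rightarrow> nat \<Rightarrow> nat \<times> nat" where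
  "pleat_class i j q = (if even q then (i, seam (q = 0) j) else (seam (q = 1) i, j))"

text \<open>
  The crease that arises by joining, indexed by any of the cells that it passes through.
\<close>
definition grid_pleat where
  "grid_pleat i j q b = \<Union>{cell_pleat i' j' q b | i' j'. i' < m \<and> j' < n \<and> pleat_class i' j' q = pleat_class i j q}"

lemma l: "0 < l"
  using a al by simp

lemma place_eqD:
  assumes "place i j w = place i' j' w'"
    and "\<bar>Re w\<bar> \<le> l \<and> \<bar>Im w\<bar> \<le> l" "\<bar>Re w'\<bar> \<le> l \<and> \<bar>Im w'\<bar> \<le> l"
  shows "w = w'"
    and "j = j' \<or> Re w = l \<and> seam True j = seam True j' \<or> Re w = - l \<and> seam False j = seam False j'"
    and "i = i' \<or> Im w = l \<and> seam True i = seam True i' \<or> Im w = - l \<and> seam False i = seam False i'"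
proof -
  have "mirror_coord l j (Re w) = mirror_coord l j' (Re w')" "mirror_coord l i (Im w) = mirror_coord l i' (Im w')"
    using assms(1) by (simp_all add: place_cell_mirror_coord)
  then have *: "Re w = Re w' \<and> (j = j' \<or> Re w = l \<and> seam True j = seam True j' \<or>
        Re w = - l \<and> seam False j = seam False j')"
      "Im w = Im w' \<and> (i = i' \<or> Im w = l \<and> seam True i = seam True i' \<or>
        Im w = - l \<and> seam False i = seam False i')"
    using assms(2,3) by (intro mirror_coord_meet[OF l]; simp)+
  show "w = w'"
    using * by (simp add: complex_eq_iff)
  show "j = j' \<or> Re w = l \<and> seam True j = seam True j' \<or> Re w = - l \<and> seam False j = seam False j'"
    using * by blast
  show "i = i' \<or> Im w = l \<and> seam True i = seam True i' \<or> Im w = - l \<and> seam False i = seam False i'"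
    using * by blast
qed

lemma place_eq_interiorD:
  assumes "place i j w = place i' j' w'"
    and "\<bar>Re w\<bar> < l \<and> \<bar>Im w\<bar> < l" "\<bar>Re w'\<bar> \<le> l \<and> \<bar>Im w'\<bar> \<le> l"
  shows "w = w' \<and> i = i' \<and> j = j'"
proof -
  have w: "\<bar>Re w\<bar> \<le> l \<and> \<bar>Im w\<bar> \<le> l"
    using assms(2) by simp
  have "Re w \<noteq> l" "Re w \<noteq> - l" "Im w \<noteq> l" "Im w \<noteq> - l"
    using assms(2) by auto
  then show ?thesis
    using place_eqD[OF assms(1) w assms(3)] by simp
qed

lemma corner_interior: "q < 4 \<Longrightarrow> \<bar>Re (corner a q)\<bar> < l \<and> \<bar>Im (corner a q)\<bar> < l"
  using corner_in_cell[of q a] a al by (meson le_less_trans)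

lemma vertices_eq: "V = {grid_vertex i j q | i j q. i < m \<and> j < n \<and> q < 4}"
  unfolding grid_vertices_def twist_corners_eq grid_vertex_def by blast

lemma grid_vertex_in_V: "i < m \<Longrightarrow> j < n \<Longrightarrow> q < 4 \<Longrightarrow> grid_vertex i j q \<in> V"
  unfolding vertices_eq by blast

lemma grid_vertex_eq_iff:
  "p < 4 \<Longrightarrow> q < 4 \<Longrightarrow> grid_vertex i j p = grid_vertex i' j' q \<longleftrightarrow> i = i' \<and> j = j' \<and> p = q"
  unfolding grid_vertex_def
  using place_eq_interiorD[of i j "corner a p" i' j' "corner a q"] corner_interior[of p]
    corner_interior[of q] corner_inj[OF a, of p q] by auto

lemma sides_eq: "grid_sides a l m n = {grid_side i j q | i j q. i < m \<and> j < n \<and> q < 4}"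
  unfolding grid_sides_def twist_sides_eq grid_side_def by blast

lemma cell_pleats_eq: "cell_pleats a l m n = {cell_pleat i j q b | i j q b. i < m \<and> j < n \<and> q < 4}"
proof -
  have "image (place i j) ` twist_pleats a l = {cell_pleat i j q b | q b. q < 4}" for i j
    unfolding twist_pleats_eq cell_pleat_def by (auto simp: image_iff)
  then show ?thesis
    unfolding cell_pleats_def by auto
qed

lemma grid_vertex_mem_grid_side:
  assumes "p < 4" "q < 4"
  shows "grid_vertex i j p \<in> grid_side i' j' q \<longleftrightarrow> i = i' \<and> j = j' \<and> (p = q \<or> p = (q + 1) mod 4)"
proof
  assume "grid_vertex i j p \<in> grid_side i' j' q"
  then obtain w where w: "w \<in> side a q" "place i j (corner a p) = place i' j' w"
    unfolding grid_vertex_def grid_side_def by blast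
  have "corner a p = w \<and> i = i' \<and> j = j'"
    by (rule place_eq_interiorD[OF w(2) corner_interior[OF assms(1)]])
      (use side_in_cell[OF assms(2) a w(1)] al in linarith)
  then show "i = i' \<and> j = j' \<and> (p = q \<or> p = (q + 1) mod 4)"
    using w(1) corner_mem_side[OF assms a] by auto
next
  assume "i = i' \<and> j = j' \<and> (p = q \<or> p = (q + 1) mod 4)"
  then show "grid_vertex i j p \<in> grid_side i' j' q"
    using corner_mem_side[OF assms a] unfolding grid_vertex_def grid_side_def by auto
qed

lemma grid_vertex_mem_cell_pleat:
  assumes "p < 4" "q < 4"
  shows "grid_vertex i j p \<in> cell_pleat i' j' q b \<longleftrightarrow>
    i = i' \<and> j = j' \<and> p = (if b then (q + 1) mod 4 else q)"
proof
  assume "grid_vertex i j p \<in> cell_pleat i' j' q b"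
  then obtain w where w: "w \<in> pleat a l q b" "place i j (corner a p) = place i' j' w"
    unfolding grid_vertex_def cell_pleat_def by blast
  have "corner a p = w \<and> i = i' \<and> j = j'"
    by (rule place_eq_interiorD[OF w(2) corner_interior[OF assms(1)]
          pleat_in_cell[OF assms(2) a al w(1)]])
  then show "i = i' \<and> j = j' \<and> p = (if b then (q + 1) mod 4 else q)"
    using w(1) corner_mem_pleat[OF assms a al] by auto
next
  assume "i = i' \<and> j = j' \<and> p = (if b then (q + 1) mod 4 else q)"
  then show "grid_vertex i j p \<in> cell_pleat i' j' q b"
    using corner_mem_pleat[OF assms a al, of b] unfolding grid_vertex_def cell_pleat_def by auto
qed

lemma mem_grid_pleat:
  "z \<in> grid_pleat i j q b \<longleftrightarrow> (\<exists>i'<m. \<exists>j'<n. pleat_class i' j' q = pleat_class i j q \<and> z \<in> cell_pleat i' j' q b)"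
  unfolding grid_pleat_def by auto

lemma grid_vertex_mem_grid_pleat:
  assumes "p < 4" "q < 4" "i < m" "j < n"
  shows "grid_vertex i j p \<in> grid_pleat i' j' q b \<longleftrightarrow>
    pleat_class i j q = pleat_class i' j' q \<and> p = (if b then (q + 1) mod 4 else q)"
  unfolding mem_grid_pleat grid_vertex_mem_cell_pleat[OF assms(1,2)] using assms(3,4) by auto

lemma border_in_cell_pleat: "q < 4 \<Longrightarrow> border i j q b \<in> cell_pleat i j q b"
  unfolding border_def cell_pleat_def pleat_def by auto

lemma border_point_in_cell:
  "q < 4 \<Longrightarrow> \<bar>Re (turned q l (if b then a else 0))\<bar> \<le> l \<and> \<bar>Im (turned q l (if b then a else 0))\<bar> \<le> l"
  by (elim less_4_cases) (use a al in \<open>auto simp: turned_simps\<close>)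

lemma border_notin_V: "q < 4 \<Longrightarrow> border i j q b \<notin> V"
proof
  assume q: "q < 4" and "border i j q b \<in> V"
  then obtain i' j' p where p: "p < 4" "place i' j' (corner a p) = place i j (turned q l (if b then a else 0))"
    unfolding vertices_eq border_def grid_vertex_def by auto
  have "corner a p = turned q l (if b then a else 0)"
    using place_eq_interiorD[OF p(2) corner_interior[OF p(1)] border_point_in_cell[OF q]] by blast
  then show False
    using q corner_interior[OF p(1)] l by (elim less_4_cases) (auto simp: turned_simps)
qed

lemma mirror_coord_eq_inside: "\<bar>y\<bar> < l \<Longrightarrow> mirror_coord l i y = mirror_coord l i' y \<longleftrightarrow> i = i'"
  using mirror_coord_meet[OF l, of y y i i'] by auto

lemma border_eq_iff:
  assumes "q < 4"
  shows "border i j q b = border i' j' q b \<longleftrightarrow> pleat_class i j q = pleat_class i' j' q"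
proof -
  define y where "y = (if b then a else 0)"
  have "\<bar>y\<bar> < l"
    using a al by (simp add: y_def)
  then have inside: "mirror_coord l k y = mirror_coord l k' y \<longleftrightarrow> k = k'" "mirror_coord l k (- y) = mirror_coord l k' (- y) \<longleftrightarrow> k = k'" for k k'
    by (simp_all add: mirror_coord_eq_inside)
  have ends: "mirror_coord l k l = mirror_coord l k' l \<longleftrightarrow> seam True k = seam True k'"
    "mirror_coord l k (- l) = mirror_coord l k' (- l) \<longleftrightarrow> seam False k = seam False k'" for k k'
    using mirror_coord_border_eq_iff[OF l, of k True k'] mirror_coord_border_eq_iff[OF l, of k False k'] by simp_all
  show ?thesis
    unfolding border_def y_def[symmetric] using assms
    by (elim less_4_cases) (auto simp: turned_simps place_cell_mirror_coord inside ends pleat_class_def)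
qed

text \<open>
  Folding both cells back onto one of them turns a common point into a common point of two pleats of
  the single twist. These meet only in corners unless they are equal, and then the common point is
  where the pleat crosses from one cell to the other.
\<close>
lemma cell_pleat_meet:
  assumes "q < 4" "q' < 4" "i < m" "j < n"
    and "z \<in> cell_pleat i j q b" "z \<in> cell_pleat i' j' q' b'" "z \<notin> V"
  shows "q = q' \<and> b = b' \<and> pleat_class i j q = pleat_class i' j' q"
proof -
  obtain w where w: "z = place i j w" "w \<in> pleat a l q b"
    using assms(5) unfolding cell_pleat_def by blast
  obtain w' where w': "z = place i' j' w'" "w' \<in> pleat a l q' b'"
    using assms(6) unfolding cell_pleat_def by blast
  note D = place_eqD[OF w(1)[unfolded w'(1), symmetric] pleat_in_cell[OF assms(1) a al w(2)]
      pleat_in_cell[OF assms(2) a al w'(2)]]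
  have "w \<notin> twist_corners a"
    using assms(3,4,7) w(1) unfolding grid_vertices_def by blast
  then have qb: "q = q'" "b = b'"
    using pleats_meet_at_corner[OF assms(1,2) a al w(2)] w'(2) D(1) by auto
  obtain x where x: "(if b then 0 else a) \<le> x" "x \<le> l" "w = turned q x (if b then a else 0)"
    using w(2) mem_pleat[OF assms(1) a al] by blast
  have "pleat_class i j q = pleat_class i' j' q"
    using assms(1) D(2,3) x a al
    by (elim less_4_cases) (auto simp: pleat_class_def turned_simps split: if_splits)
  then show ?thesis
    using qb by simp
qed

text \<open>
  Pieces of one class share their border point, which is not a vertex, and by \<open>cell_pleat_meet\<close>
  pieces of different classes meet in vertices only. So the joining rule collects exactly a class.
\<close>
lemma pleats_eq: "grid_pleats a l m n = {grid_pleat i j q b | i j q b. i < m \<and> j < n \<and> q < 4}"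
proof -
  have merge: "\<Union>{t \<in> cell_pleats a l m n. cell_pleat i j q b \<inter> t - V \<noteq> {}} = grid_pleat i j q b"
    if "i < m" "j < n" "q < 4" for i j q b
  proof -
    have "{t \<in> cell_pleats a l m n. cell_pleat i j q b \<inter> t - V \<noteq> {}} =
        {cell_pleat i' j' q b | i' j'. i' < m \<and> j' < n \<and> pleat_class i' j' q = pleat_class i j q}" (is "?L = ?R")
    proof (intro equalityI subsetI)
      fix t assume "t \<in> ?L"
      then obtain i' j' q' b' z where t: "t = cell_pleat i' j' q' b'" "i' < m" "j' < n" "q' < 4"
        and z: "z \<in> cell_pleat i j q b" "z \<in> cell_pleat i' j' q' b'" "z \<notin> V"
        unfolding cell_pleats_eq by blast
      have same: "q = q' \<and> b = b' \<and> pleat_class i j q = pleat_class i' j' q"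
        using cell_pleat_meet[OF that(3) t(4) that(1,2) z] .
      then have "pleat_class i' j' q = pleat_class i j q"
        by (elim conjE) (rule sym)
      moreover have "t = cell_pleat i' j' q b"
        using t(1) same by simp
      ultimately show "t \<in> ?R"
        using t(2,3) by blast
    next
      fix t assume "t \<in> ?R"
      then obtain i' j' where t: "t = cell_pleat i' j' q b" "i' < m" "j' < n" "pleat_class i' j' q = pleat_class i j q"
        by blast
      have "border i j q b = border i' j' q b"
        by (subst border_eq_iff[OF that(3)]) (rule t(4)[symmetric])
      then have "border i j q b \<in> t"
        unfolding t(1) using border_in_cell_pleat[OF that(3), of i' j' b] by simp
      then have "border i j q b \<in> cell_pleat i j q b \<inter> t - V"
        using border_in_cell_pleat[OF that(3), of i j b] border_notin_V[OF that(3), of i j b] by blast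
      then show "t \<in> ?L"
        using t that(3) unfolding cell_pleats_eq by blast
    qed
    then show ?thesis
      unfolding grid_pleat_def by simp
  qed
  show ?thesis
  proof (intro equalityI subsetI)
    fix c assume "c \<in> grid_pleats a l m n"
    then obtain s where s: "s \<in> cell_pleats a l m n"
      "c = \<Union>{t \<in> cell_pleats a l m n. s \<inter> t - V \<noteq> {}}"
      unfolding grid_pleats_def by blast
    then obtain i j q b where ijq: "i < m" "j < n" "q < 4" "s = cell_pleat i j q b"
      unfolding cell_pleats_eq by blast
    then have "c = grid_pleat i j q b"
      using s(2) merge by simp
    then show "c \<in> {grid_pleat i j q b | i j q b. i < m \<and> j < n \<and> q < 4}"
      using ijq by blast
  next
    fix c assume "c \<in> {grid_pleat i j q b | i j q b. i < m \<and> j < n \<and> q < 4}"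
    then obtain i j q b where ijq: "i < m" "j < n" "q < 4" "c = grid_pleat i j q b"
      by blast
    then have "cell_pleat i j q b \<in> cell_pleats a l m n"
      unfolding cell_pleats_eq by blast
    then show "c \<in> grid_pleats a l m n"
      unfolding grid_pleats_def ijq(4) merge[OF ijq(1-3), symmetric] by blast
  qed
qed

lemma grid_pleat_cong: "pleat_class i j q = pleat_class i' j' q \<Longrightarrow> grid_pleat i j q b = grid_pleat i' j' q b"
  unfolding grid_pleat_def by simp

lemma border_in_grid_pleat: "i < m \<Longrightarrow> j < n \<Longrightarrow> q < 4 \<Longrightarrow> border i j q b \<in> grid_pleat i j q b"
  unfolding mem_grid_pleat using border_in_cell_pleat by blast

text \<open>
  A border point of a crease recovers the class.
\<close>
lemma grid_pleat_eq_iff: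
  assumes "i < m" "j < n" "q < 4" "i' < m" "j' < n" "q' < 4"
  shows "grid_pleat i j q b = grid_pleat i' j' q' b' \<longleftrightarrow> q = q' \<and> b = b' \<and> pleat_class i j q = pleat_class i' j' q"
proof
  assume "grid_pleat i j q b = grid_pleat i' j' q' b'"
  then have "border i j q b \<in> grid_pleat i' j' q' b'"
    using border_in_grid_pleat[OF assms(1-3), of b] by simp
  then obtain i'' j'' where *: "pleat_class i'' j'' q' = pleat_class i' j' q'" "border i j q b \<in> cell_pleat i'' j'' q' b'"
    unfolding mem_grid_pleat by blast
  have "q = q' \<and> b = b' \<and> pleat_class i j q = pleat_class i'' j'' q"
    by (rule cell_pleat_meet[OF assms(3,6,1,2) border_in_cell_pleat[OF assms(3)] *(2) border_notin_V[OF assms(3)]])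
  then show "q = q' \<and> b = b' \<and> pleat_class i j q = pleat_class i' j' q"
    using *(1) by auto
next
  assume *: "q = q' \<and> b = b' \<and> pleat_class i j q = pleat_class i' j' q"
  then have "grid_pleat i j q b = grid_pleat i' j' q b"
    by (intro grid_pleat_cong) (elim conjE)
  then show "grid_pleat i j q b = grid_pleat i' j' q' b'"
    using * by (elim conjE) (simp only:)
qed

lemma grid_side_eq_iff:
  assumes "q < 4" "q' < 4"
  shows "grid_side i j q = grid_side i' j' q' \<longleftrightarrow> i = i' \<and> j = j' \<and> q = q'"
proof
  assume eq: "grid_side i j q = grid_side i' j' q'"
  have "(q + 1) mod 4 < 4" by simp
  then have "grid_vertex i j q \<in> grid_side i' j' q'" "grid_vertex i j ((q + 1) mod 4) \<in> grid_side i' j' q'"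
    using grid_vertex_mem_grid_side assms eq by metis+
  then show "i = i' \<and> j = j' \<and> q = q'"
    using assms unfolding grid_vertex_mem_grid_side[OF assms] grid_vertex_mem_grid_side[OF \<open>(q + 1) mod 4 < 4\<close> assms(2)]
    by (elim less_4_cases) auto
qed auto

text \<open>
  A side contains two corners of one square, a pleat crease only one.
\<close>
lemma grid_side_neq_grid_pleat:
  assumes "i < m" "j < n" "q < 4" "q' < 4"
  shows "grid_side i j q \<noteq> grid_pleat i' j' q' b"
proof
  assume eq: "grid_side i j q = grid_pleat i' j' q' b"
  have q1: "(q + 1) mod 4 < 4" by simp
  then have "grid_vertex i j q \<in> grid_pleat i' j' q' b" "grid_vertex i j ((q + 1) mod 4) \<in> grid_pleat i' j' q' b"
    using grid_vertex_mem_grid_side assms(3) eq by metis+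
  then have "q = (if b then (q' + 1) mod 4 else q')" "(q + 1) mod 4 = (if b then (q' + 1) mod 4 else q')"
    unfolding grid_vertex_mem_grid_pleat[OF assms(3,4,1,2)] grid_vertex_mem_grid_pleat[OF q1 assms(4,1,2)] by blast+
  then have "(q + 1) mod 4 = q"
    by (simp only:)
  then show False
    using assms(3) by (elim less_4_cases) simp_all
qed

end

section \<open>Creases as segments\<close>

lemma ray_iff: "k < 4 \<Longrightarrow> z \<in> ray k \<longleftrightarrow> (\<exists>s\<ge>0. z = of_real s * ray_point k)"
proof -
  assume k: "k < 4"
  show ?thesis
  proof
    assume "z \<in> ray k"
    then show "\<exists>s\<ge>0. z = of_real s * ray_point k"
      using k by (elim less_4_cases; intro exI[of _ "if k = 0 then Re z else if k = 1 then 2 * Im z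
          else if k = 2 then - 2 * Re z else - Im z"])
        (simp_all add: ray_def ray_point_def complex_eq_iff)
  next
    assume "\<exists>s\<ge>0. z = of_real s * ray_point k"
    then show "z \<in> ray k"
      using k by (elim exE conjE less_4_cases) (simp_all add: ray_def ray_point_def)
  qed
qed

lemma segment_cball_ray:
  assumes "k < 4" "0 < t" "r < norm (of_real t * ray_point k)"
  shows "closed_segment 0 (of_real t * ray_point k) \<inter> cball 0 r = ray k \<inter> cball 0 r"
proof (intro equalityI subsetI)
  fix z assume "z \<in> closed_segment 0 (of_real t * ray_point k) \<inter> cball 0 r"
  then obtain u where u: "0 \<le> u" "z = u *\<^sub>R (of_real t * ray_point k)" "z \<in> cball 0 r"
    by (auto simp: in_segment)
  then have "z = of_real (u * t) * ray_point k" "0 \<le> u * t"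
    using assms(2) by (simp_all add: scaleR_conv_of_real)
  then show "z \<in> ray k \<inter> cball 0 r"
    using u(3) ray_iff[OF assms(1)] by blast
next
  fix z assume z: "z \<in> ray k \<inter> cball 0 r"
  then obtain s where s: "0 \<le> s" "z = of_real s * ray_point k"
    using ray_iff[OF assms(1)] by blast
  have "norm (of_real s * ray_point k) < norm (of_real t * ray_point k)"
    using z s(2) assms(3) by simp
  then have "s * norm (ray_point k) < t * norm (ray_point k)"
    using s(1) assms(2) by (simp add: norm_mult)
  then have "s < t"
    by (rule mult_right_less_imp_less) simp
  have "z = (s / t) *\<^sub>R (of_real t * ray_point k)"
    using s(2) assms(2) by (simp add: scaleR_conv_of_real)
  moreover have "0 \<le> s / t" "s / t \<le> 1"
    using s(1) assms(2) \<open>s < t\<close> by simp_all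
  ultimately have "z \<in> closed_segment 0 (of_real t * ray_point k)"
    unfolding in_segment by (intro exI[of _ "s / t"]) simp
  then show "z \<in> closed_segment 0 (of_real t * ray_point k) \<inter> cball 0 r"
    using z by blast
qed

text \<open>
  A crease that leaves the disk looks inside the disk like a full ray.
\<close>
lemma rigid_segment_cball:
  assumes "rigid \<phi>" "k < 4" "0 < t" "\<phi> (of_real t * ray_point k) \<notin> cball (\<phi> 0) r"
  shows "closed_segment (\<phi> 0) (\<phi> (of_real t * ray_point k)) \<inter> cball (\<phi> 0) r = \<phi> ` (ray k \<inter> cball 0 r)"
proof -
  have "r < norm (of_real t * ray_point k)"
    using assms(4) rigid_dist[OF assms(1), of 0 "of_real t * ray_point k"] by simp
  then show ?thesis
    using segment_cball_ray[OF assms(2,3)] image_Int[OF rigid_inj[OF assms(1)]]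
    by (metis rigid_closed_segment[OF assms(1)] rigid_image_cball[OF assms(1)])
qed

lemma corner_as_turned:
  "q < 4 \<Longrightarrow> turned q (if b then 0 else a) (if b then a else 0) = corner a (if b then (q + 1) mod 4 else q)"
  by (elim less_4_cases) (auto simp: corner_def turned_simps)

text \<open>
  The corner \<open>q\<close> and points on its four creases in the coordinates of the model corner, in
  which the corner is the origin: along ray \<open>0\<close> a pleat crease of side \<open>q\<close>, along the rays \<open>1\<close> and \<open>2\<close>
  the sides \<open>q\<close> and \<open>q - 1\<close>, along ray \<open>3\<close> a pleat crease of side \<open>q - 1\<close>. The index \<open>q - 1\<close> is
  \<open>(q + 3) mod 4\<close>.
\<close>
lemma crease_ends:
  assumes "q < 4"
  shows "corner a q = \<i> ^ q * (of_real a + 0)"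
    and "turned q x 0 = \<i> ^ q * (of_real a + of_real (x - a) * ray_point 0)"
    and "corner a (q + 1) = \<i> ^ q * (of_real a + of_real (2 * a) * ray_point 1)"
    and "corner a ((q + 3) mod 4) = \<i> ^ q * (of_real a + of_real (2 * a) * ray_point 2)"
    and "turned ((q + 3) mod 4) x a = \<i> ^ q * (of_real a + of_real x * ray_point 3)"
    and "corner a ((q + 3) mod 4 + 1) = corner a q"
  using assms by (elim less_4_cases;
      simp add: corner_def turned_def ray_point_def complex_eq_iff power_numeral_reduce)+

context twist_grid
begin

text \<open>
  In the coordinates of one cell, the neighbour beyond the edge at distance \<open>l\<close> is its mirror image
  in that edge.
\<close>
lemma partner_reflects:
  assumes "q < 4" "pleat_class i' j' q = pleat_class i j q" "(i', j') \<noteq> (i, j)"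
  shows "place i' j' (turned q x y) = place i j (turned q (2 * l - x) y)"
  using assms mirror_coord_reflect[of True j' j l x] mirror_coord_reflect[of True i' i l x]
    mirror_coord_reflect[of False j' j l "- x"] mirror_coord_reflect[of False i' i l "- x"]
  by (elim less_4_cases) (auto simp: pleat_class_def turned_simps place_cell_mirror_coord)

lemma pleat_class_fiber:
  assumes "q < 4" "pleat_class i' j' q = pleat_class i j q" "(i', j') \<noteq> (i, j)"
    "pleat_class i'' j'' q = pleat_class i j q" "(i'', j'') \<noteq> (i, j)"
  shows "i'' = i'" "j'' = j'"
proof -
  have "i'' = i' \<and> j'' = j'"
  proof (cases "even q")
    case True
    then have "i' = i" "i'' = i" "seam (q = 0) j' = seam (q = 0) j" "seam (q = 0) j'' = seam (q = 0) j"
      using assms(2,4) by (simp_all add: pleat_class_def)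
    moreover from this have "j' \<noteq> j" "j'' \<noteq> j"
      using assms(3,5) by simp_all
    ultimately show ?thesis
      using seam_fiber[of "q = 0" j' j] seam_fiber[of "q = 0" j'' j] by simp
  next
    case False
    then have "j' = j" "j'' = j" "seam (q = 1) i' = seam (q = 1) i" "seam (q = 1) i'' = seam (q = 1) i"
      using assms(2,4) by (simp_all add: pleat_class_def)
    moreover from this have "i' \<noteq> i" "i'' \<noteq> i"
      using assms(3,5) by simp_all
    ultimately show ?thesis
      using seam_fiber[of "q = 1" i' i] seam_fiber[of "q = 1" i'' i] by simp
  qed
  then show "i'' = i'" "j'' = j'" by simp_all
qed

lemma mirror_coord_bounds:
  assumes "j < n'" "\<bar>x\<bar> \<le> l"
  shows "- l \<le> mirror_coord l j x \<and> mirror_coord l j x \<le> l * (2 * real n' - 1)"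
proof -
  have "\<bar>(- 1) ^ j * x\<bar> \<le> l"
    using assms(2) by (simp add: abs_mult)
  moreover have "0 \<le> l * real j"
    using l by simp
  moreover have "l * real (j + 1) \<le> l * real n'"
    using assms(1) l by (intro mult_left_mono) linarith+
  then have "l * real j + l \<le> l * real n'"
    by (simp add: distrib_left)
  moreover have "mirror_coord l j x = 2 * (l * real j) + (- 1) ^ j * x"
    by (simp add: mirror_coord_def)
  moreover have "l * (2 * real n' - 1) = 2 * (l * real n') - l"
    by (simp add: algebra_simps)
  ultimately show ?thesis
    by linarith
qed

lemma sheet_subset:
  "X \<subseteq> cbox (Complex (- l) (- l)) (Complex (l * (2 * real n - 1)) (l * (2 * real m - 1)))"
proof
  fix z assume "z \<in> X"
  then obtain i j w where "i < m" "j < n" "z = place i j w" "w \<in> cbox (Complex (- l) (- l)) (Complex l l)"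
    unfolding grid_sheet_def by blast
  then show "z \<in> cbox (Complex (- l) (- l)) (Complex (l * (2 * real n - 1)) (l * (2 * real m - 1)))"
    using mirror_coord_bounds[of j n "Re w"] mirror_coord_bounds[of i m "Im w"]
    by (simp add: in_cbox_complex_iff place_cell_mirror_coord abs_le_iff)
qed

lemma interior_sheet:
  assumes "z \<in> interior X"
  shows "- l < Re z" "Re z < l * (2 * real n - 1)" "- l < Im z" "Im z < l * (2 * real m - 1)"
proof -
  have "z \<in> box (Complex (- l) (- l)) (Complex (l * (2 * real n - 1)) (l * (2 * real m - 1)))"
    using interior_mono[OF sheet_subset] assms by (auto simp: interior_cbox)
  then show "- l < Re z" "Re z < l * (2 * real n - 1)" "- l < Im z" "Im z < l * (2 * real m - 1)"
    by (simp_all add: in_box_complex_iff)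
qed

lemma border_on_boundary:
  assumes "i < m" "j < n" "q < 4"
    and alone: "\<And>i' j'. i' < m \<Longrightarrow> j' < n \<Longrightarrow> pleat_class i' j' q = pleat_class i j q \<Longrightarrow> i' = i \<and> j' = j"
  shows "border i j q b \<notin> interior X"
proof
  assume in_int: "border i j q b \<in> interior X"
  show False
  proof (cases "even q")
    case True
    have "j' = j" if "j' < n" "seam (q = 0) j' = seam (q = 0) j" for j'
      using alone[of i j'] that assms(1) True by (simp add: pleat_class_def)
    then have "seam (q = 0) j = 0 \<or> seam (q = 0) j = n"
      using seam_partner[OF assms(2)] by blast
    moreover have "Re (border i j q b) = l * (2 * real (seam (q = 0) j) - 1)"
      using True assms(3) mirror_coord_border[of l j "q = 0"]
      by (elim less_4_cases) (auto simp: border_def turned_simps place_cell_mirror_coord)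
    ultimately show False
      using interior_sheet(1,2)[OF in_int] by auto
  next
    case False
    have "i' = i" if "i' < m" "seam (q = 1) i' = seam (q = 1) i" for i'
      using alone[of i' j] that assms(2) False by (simp add: pleat_class_def)
    then have "seam (q = 1) i = 0 \<or> seam (q = 1) i = m"
      using seam_partner[OF assms(1)] by blast
    moreover have "Im (border i j q b) = l * (2 * real (seam (q = 1) i) - 1)"
      using False assms(3) mirror_coord_border[of l i "q = 1"]
      by (elim less_4_cases) (auto simp: border_def turned_simps place_cell_mirror_coord)
    ultimately show False
      using interior_sheet(3,4)[OF in_int] by auto
  qed
qed

lemma cell_pleat_segment:
  "cell_pleat i j q b = closed_segment (place i j (turned q (if b then 0 else a) (if b then a else 0))) (border i j q b)"
  unfolding cell_pleat_def pleat_def border_def by (rule rigid_closed_segment[OF rigid_place_cell])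

text \<open>
  A pleat crease is a segment that ends in the mirror image of its initial vertex or, if there is no
  neighbouring cell, on the boundary of the sheet. A small disk contains neither kind of
  end.
\<close>
lemma grid_pleat_segment:
  fixes b :: bool
  assumes "i < m" "j < n" "q < 4"
  defines "x0 \<equiv> (if b then 0 else a)" and "y \<equiv> (if b then a else 0)"
    and "v \<equiv> grid_vertex i j (if b then (q + 1) mod 4 else q)"
  shows "\<exists>x>x0. grid_pleat i j q b = closed_segment v (place i j (turned q x y)) \<and>
    (place i j (turned q x y) \<in> V - {v} \<or> place i j (turned q x y) \<notin> interior X)"
proof -
  define p where "p = (if b then (q + 1) mod 4 else q)"
  have p: "p < 4" using assms(3) by (simp add: p_def)
  have start: "place i' j' (turned q x0 y) = grid_vertex i' j' p" for i' j'
    unfolding grid_vertex_def p_def x0_def y_def corner_as_turned[OF assms(3)] ..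
  have v: "v = grid_vertex i j p" by (simp add: v_def p_def)
  have x0: "x0 < l" using a al by (simp add: x0_def)
  have cell_pleat: "cell_pleat i' j' q b = closed_segment (grid_vertex i' j' p) (border i' j' q b)" for i' j'
    unfolding cell_pleat_segment x0_def[symmetric] y_def[symmetric] start ..
  have border: "border i' j' q b = place i' j' (turned q l y)" for i' j'
    by (simp add: border_def y_def)
  show ?thesis
  proof (cases "\<exists>i'<m. \<exists>j'<n. pleat_class i' j' q = pleat_class i j q \<and> (i', j') \<noteq> (i, j)")
    case True
    then obtain i' j' where ij': "i' < m" "j' < n" "pleat_class i' j' q = pleat_class i j q" "(i', j') \<noteq> (i, j)"
      by blast
    have "grid_pleat i j q b = cell_pleat i j q b \<union> cell_pleat i' j' q b"
    proof (intro equalityI subsetI)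
      fix z assume "z \<in> grid_pleat i j q b"
      then obtain i'' j'' where c: "pleat_class i'' j'' q = pleat_class i j q" "z \<in> cell_pleat i'' j'' q b"
        unfolding mem_grid_pleat by blast
      show "z \<in> cell_pleat i j q b \<union> cell_pleat i' j' q b"
        using c pleat_class_fiber[OF assms(3) ij'(3,4) c(1)] by (cases "(i'', j'') = (i, j)") auto
    next
      fix z assume "z \<in> cell_pleat i j q b \<union> cell_pleat i' j' q b"
      then show "z \<in> grid_pleat i j q b"
        using assms(1,2) ij'(1-3) unfolding mem_grid_pleat by blast
    qed
    also have "cell_pleat i' j' q b = closed_segment (border i j q b) (grid_vertex i' j' p)"
      using border_eq_iff[OF assms(3), of i' j' b i j] ij'(3) by (simp add: cell_pleat closed_segment_commute)
    also have "cell_pleat i j q b \<union> closed_segment (border i j q b) (grid_vertex i' j' p) =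
        closed_segment (grid_vertex i j p) (grid_vertex i' j' p)"
      unfolding cell_pleat
    proof (rule Un_closed_segment)
      have far: "grid_vertex i' j' p = place i j (turned q (2 * l - x0) y)"
        using start[of i' j'] partner_reflects[OF assms(3) ij'(3,4)] by simp
      have "turned q l y = (1 - 1 / 2) *\<^sub>R turned q x0 y + (1 / 2) *\<^sub>R turned q (2 * l - x0) y"
        by (simp add: turned_def complex_eq_iff algebra_simps flip: scaleR_right_distrib)
      then have "turned q l y \<in> closed_segment (turned q x0 y) (turned q (2 * l - x0) y)"
        unfolding in_segment by (intro exI[of _ "1/2"]) simp
      then have "place i j (turned q l y) \<in> place i j ` closed_segment (turned q x0 y) (turned q (2 * l - x0) y)"
        by (rule imageI)
      then show "border i j q b \<in> closed_segment (grid_vertex i j p) (grid_vertex i' j' p)"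
        unfolding rigid_closed_segment[OF rigid_place_cell] far border start[of i j] .
    qed
    finally have "grid_pleat i j q b = closed_segment v (place i j (turned q (2 * l - x0) y))"
      using start[of i' j'] partner_reflects[OF assms(3) ij'(3,4)] by (simp add: v)
    moreover have "place i j (turned q (2 * l - x0) y) \<in> V - {v}"
      using start[of i' j'] partner_reflects[OF assms(3) ij'(3,4), of x0 y]
        grid_vertex_in_V[OF ij'(1,2) p] grid_vertex_eq_iff[OF p p, of i' j' i j] ij'(4) by (auto simp: v)
    moreover have "2 * l - x0 > x0" using x0 by simp
    ultimately show ?thesis by blast
  next
    case False
    then have alone: "i' = i \<and> j' = j" if "i' < m" "j' < n" "pleat_class i' j' q = pleat_class i j q" for i' j'
      using that by blast
    have "grid_pleat i j q b = cell_pleat i j q b"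
    proof (intro equalityI subsetI)
      fix z assume "z \<in> grid_pleat i j q b"
      then show "z \<in> cell_pleat i j q b"
        using alone unfolding mem_grid_pleat by blast
    next
      fix z assume "z \<in> cell_pleat i j q b"
      then show "z \<in> grid_pleat i j q b"
        using assms(1,2) unfolding mem_grid_pleat by blast
    qed
    then have seg: "grid_pleat i j q b = closed_segment v (place i j (turned q l y))"
      by (simp add: cell_pleat v border)
    have out: "place i j (turned q l y) \<notin> interior X"
      unfolding border[symmetric] by (rule border_on_boundary[OF assms(1-3)]) (rule alone)
    show ?thesis
      by (rule exI[of _ l], rule conjI[OF x0 conjI[OF seg disjI2[OF out]]])
  qed
qed

lemma grid_side_segment: "grid_side i j q = closed_segment (grid_vertex i j q) (place i j (corner a (q + 1)))"
  unfolding grid_side_def side_def grid_vertex_def by (rule rigid_closed_segment[OF rigid_place_cell])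

end

section \<open>Corner conditions in the tessellation\<close>

context twist_grid
begin

text \<open>
  The model coordinates at the corner \<open>q\<close> of a cell.
\<close>
definition frame :: "nat \<Rightarrow> nat \<Rightarrow> nat \<Rightarrow> complex \<Rightarrow> complex" where
  "frame i j q h = place i j (\<i> ^ q * (of_real a + h))"

definition crease :: "nat \<Rightarrow> nat \<Rightarrow> nat \<Rightarrow> nat \<Rightarrow> complex set" where
  "crease i j q k =
     (if k = 0 then grid_pleat i j q False else if k = 1 then grid_side i j q
      else if k = 2 then grid_side i j ((q + 3) mod 4) else grid_pleat i j ((q + 3) mod 4) True)"

lemma rigid_frame: "rigid (frame i j q)"
proof -
  have "direct_isometry_on UNIV (\<lambda>h. \<i> ^ q * (of_real a + h))"
    by (rule direct_isometryI[of "\<i> ^ q" _ _ "\<i> ^ q * of_real a"])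
      (simp_all add: norm_power algebra_simps)
  then have "rigid (place i j \<circ> (\<lambda>h. \<i> ^ q * (of_real a + h)))"
    using rigid_place_cell[of l i j] orientation_post(1,3) unfolding rigid_def by blast
  then show ?thesis
    by (simp add: frame_def[abs_def] o_def)
qed

lemma frame_0: "q < 4 \<Longrightarrow> frame i j q 0 = grid_vertex i j q"
  unfolding frame_def grid_vertex_def by (simp only: crease_ends(1))

lemma creases_at_grid_vertex:
  assumes "i < m" "j < n" "q < 4"
  shows "{e \<in> E. grid_vertex i j q \<in> e} = crease i j q ` {..<4}"
proof (intro equalityI subsetI)
  define p where "p = (q + 3) mod 4"
  have p: "p < 4" by (simp add: p_def)
  have qp: "q = q' \<or> q = (q' + 1) mod 4 \<longleftrightarrow> q' = q \<or> q' = p" "q = (q' + 1) mod 4 \<longleftrightarrow> q' = p"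
    if "q' < 4" for q'
    using that assms(3) unfolding p_def by (elim less_4_cases; simp)+
  {
    fix e assume "e \<in> {e \<in> E. grid_vertex i j q \<in> e}"
    then have e: "grid_vertex i j q \<in> e" "e \<in> grid_sides a l m n \<or> e \<in> grid_pleats a l m n"
      by (simp_all add: grid_creases_def)
    have "e = crease i j q 0 \<or> e = crease i j q 1 \<or> e = crease i j q 2 \<or> e = crease i j q 3"
      using e(2)
    proof
      assume "e \<in> grid_sides a l m n"
      then obtain i' j' q' where e': "q' < 4" "e = grid_side i' j' q'"
        unfolding sides_eq by blast
      then have "i' = i" "j' = j" "q' = q \<or> q' = p"
        using e(1) grid_vertex_mem_grid_side[OF assms(3) e'(1)] qp(1)[OF e'(1)] by simp_all
      then show ?thesis
        unfolding e'(2) crease_def p_def by auto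
    next
      assume "e \<in> grid_pleats a l m n"
      then obtain i' j' q' b where e': "q' < 4" "e = grid_pleat i' j' q' b"
        unfolding pleats_eq by blast
      then have *: "pleat_class i j q' = pleat_class i' j' q'" "q = (if b then (q' + 1) mod 4 else q')"
        using e(1) grid_vertex_mem_grid_pleat[OF assms(3) e'(1) assms(1,2)] by simp_all
      have "e = grid_pleat i j q' b"
        unfolding e'(2) by (rule grid_pleat_cong) (rule *(1)[symmetric])
      moreover have "q' = (if b then p else q)"
        using *(2) qp(2)[OF e'(1)] by (simp split: if_splits)
      ultimately show ?thesis
        unfolding crease_def p_def by (cases b) simp_all
    qed
    then show "e \<in> crease i j q ` {..<4}"
      by (elim disjE) simp_all
  }
  {
    fix e assume "e \<in> crease i j q ` {..<4}"
    then obtain k where k: "k < 4" "e = crease i j q k" by auto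
    have "grid_pleat i j q False \<in> E" "grid_side i j q \<in> E" "grid_side i j p \<in> E" "grid_pleat i j p True \<in> E"
      using assms p unfolding grid_creases_def sides_eq pleats_eq by blast+
    moreover have "grid_vertex i j q \<in> grid_pleat i j q False" "grid_vertex i j q \<in> grid_side i j q"
      "grid_vertex i j q \<in> grid_side i j p" "grid_vertex i j q \<in> grid_pleat i j p True"
      using grid_vertex_mem_grid_pleat[OF assms(3,3,1,2)] grid_vertex_mem_grid_pleat[OF assms(3) p assms(1,2)]
        grid_vertex_mem_grid_side[OF assms(3,3)] grid_vertex_mem_grid_side[OF assms(3) p] qp(2)[OF p] by simp_all
    ultimately show "e \<in> {e \<in> E. grid_vertex i j q \<in> e}"
      unfolding k(2) crease_def p_def[symmetric] by simp
  }
qed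

text \<open>
  Each of the four creases ends outside the disk, in another vertex or on the boundary of the sheet.
\<close>
lemma crease_in_disk:
  assumes "i < m" "j < n" "q < 4" "k < 4" and disk: "small_disk X V E (grid_vertex i j q) r"
  shows "crease i j q k \<inter> cball (grid_vertex i j q) r = frame i j q ` (ray k \<inter> cball 0 r)"
proof -
  define p where "p = (q + 3) mod 4"
  have p: "p < 4" by (simp add: p_def)
  have outside: "w \<notin> cball (grid_vertex i j q) r" if "w \<in> V - {grid_vertex i j q} \<or> w \<notin> interior X" for w
    using disk that unfolding small_disk_def by blast
  have "\<exists>t>0. crease i j q k = closed_segment (grid_vertex i j q) (frame i j q (of_real t * ray_point k)) \<and>
      frame i j q (of_real t * ray_point k) \<notin> cball (grid_vertex i j q) r"
    using assms(4)
  proof (rule less_4_cases)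
    assume k: "k = 0"
    obtain x where x: "a < x" "grid_pleat i j q False = closed_segment (grid_vertex i j q) (place i j (turned q x 0))"
      "place i j (turned q x 0) \<in> V - {grid_vertex i j q} \<or> place i j (turned q x 0) \<notin> interior X"
      using grid_pleat_segment[OF assms(1-3), of False] by auto
    have "place i j (turned q x 0) = frame i j q (of_real (x - a) * ray_point 0)"
      unfolding frame_def by (simp only: crease_ends(2)[OF assms(3), of x a])
    then show ?thesis
      using x outside[OF x(3)] by (intro exI[of _ "x - a"]) (simp add: k crease_def)
  next
    assume k: "k = 1"
    define q1 where "q1 = (q + 1) mod 4"
    have q1: "q1 < 4" "q1 \<noteq> q" "corner a (q + 1) = corner a q1"
      using assms(3) unfolding q1_def by (elim less_4_cases; simp add: corner_def turned_simps)+
    have "place i j (corner a (q + 1)) \<in> V - {grid_vertex i j q}"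
      unfolding q1(3) grid_vertex_def[symmetric]
      using grid_vertex_in_V[OF assms(1,2) q1(1)] grid_vertex_eq_iff[OF q1(1) assms(3), of i j i j] q1(2) by simp
    then have "place i j (corner a (q + 1)) \<notin> cball (grid_vertex i j q) r"
      by (intro outside disjI1)
    moreover have "place i j (corner a (q + 1)) = frame i j q (of_real (2 * a) * ray_point 1)"
      unfolding frame_def by (simp only: crease_ends(3)[OF assms(3)])
    ultimately show ?thesis
      using a grid_side_segment[of i j q] by (intro exI[of _ "2 * a"]) (simp add: k crease_def)
  next
    assume k: "k = 2"
    have "p \<noteq> q"
      using assms(3) unfolding p_def by (elim less_4_cases; simp)
    then have "grid_vertex i j p \<in> V - {grid_vertex i j q}"
      using grid_vertex_in_V[OF assms(1,2) p] grid_vertex_eq_iff[OF p assms(3), of i j i j] by simp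
    then have "grid_vertex i j p \<notin> cball (grid_vertex i j q) r"
      by (intro outside disjI1)
    moreover have "grid_vertex i j p = frame i j q (of_real (2 * a) * ray_point 2)"
      unfolding frame_def grid_vertex_def p_def by (simp only: crease_ends(4)[OF assms(3)])
    moreover have "grid_side i j p = closed_segment (grid_vertex i j q) (grid_vertex i j p)"
      unfolding grid_side_segment p_def crease_ends(6)[OF assms(3)]
      by (simp add: grid_vertex_def closed_segment_commute)
    ultimately show ?thesis
      using a by (intro exI[of _ "2 * a"]) (simp add: k crease_def p_def)
  next
    assume k: "k = 3"
    have q: "(p + 1) mod 4 = q"
      using assms(3) unfolding p_def by (elim less_4_cases; simp)
    obtain x where x: "0 < x" "grid_pleat i j p True = closed_segment (grid_vertex i j q) (place i j (turned p x a))"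
      "place i j (turned p x a) \<in> V - {grid_vertex i j q} \<or> place i j (turned p x a) \<notin> interior X"
      using grid_pleat_segment[OF assms(1,2) p, of True] unfolding if_True q by blast
    have "place i j (turned p x a) = frame i j q (of_real x * ray_point 3)"
      unfolding frame_def p_def by (simp only: crease_ends(5)[OF assms(3), of x a])
    then show ?thesis
      using x outside[OF x(3)] by (intro exI[of _ x]) (simp add: k crease_def p_def)
  qed
  then obtain t where t: "t > 0"
    "crease i j q k = closed_segment (frame i j q 0) (frame i j q (of_real t * ray_point k))"
    "frame i j q (of_real t * ray_point k) \<notin> cball (frame i j q 0) r"
    unfolding frame_0[OF assms(3)] by blast
  show ?thesis
    unfolding t(2) frame_0[OF assms(3), symmetric]
    by (rule rigid_segment_cball[OF rigid_frame assms(4) t(1,3)])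
qed

lemma disk_folds_flat_grid_iff:
  assumes "i < m" "j < n" "q < 4" and disk: "small_disk X V E (grid_vertex i j q) r"
    and mv: "\<mu> \<in> mv_assignments E"
  shows "disk_folds_flat E \<mu> (grid_vertex i j q) r \<longleftrightarrow>
    \<mu> (grid_pleat i j q False) = \<mu> (grid_side i j q) \<and>
    \<mu> (grid_side i j ((q + 3) mod 4)) = - \<mu> (grid_pleat i j ((q + 3) mod 4) True)"
proof -
  interpret twist_vertex E "grid_vertex i j q" r "frame i j q" "crease i j q"
  proof
    show "rigid (frame i j q)" by (rule rigid_frame)
    show "frame i j q 0 = grid_vertex i j q" by (rule frame_0[OF assms(3)])
    show "0 < r" using disk by (simp add: small_disk_def)
    show "{e \<in> E. grid_vertex i j q \<in> e} = crease i j q ` {..<4}"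
      by (rule creases_at_grid_vertex[OF assms(1-3)])
    show "crease i j q k \<inter> cball (grid_vertex i j q) r = frame i j q ` (ray k \<inter> cball 0 r)" if "k < 4" for k
      by (rule crease_in_disk[OF assms(1-3) that disk])
    show "grid_vertex i j q \<in> e" if "e \<in> E" "e \<inter> cball (grid_vertex i j q) r \<noteq> {}" for e
      using disk that unfolding small_disk_def by blast
  qed
  have "\<mu> (crease i j q k) = - 1 \<or> \<mu> (crease i j q k) = 1" if "k < 4" for k
    using mv crease_in[OF that] unfolding mv_assignments_def by (auto simp: PiE_iff)
  then have "disk_folds_flat E \<mu> (grid_vertex i j q) r \<longleftrightarrow>
      \<mu> (crease i j q 0) = \<mu> (crease i j q 1) \<and> \<mu> (crease i j q 2) = - \<mu> (crease i j q 3)"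
    by (rule disk_folds_flat_iff)
  then show ?thesis
    by (simp add: crease_def)
qed

lemma finite_creases: "finite E"
  unfolding grid_creases_def grid_sides_def grid_pleats_def cell_pleats_def twist_sides_def twist_pleats_def
  by (auto intro!: finite_image_set)

lemma closed_crease:
  assumes "e \<in> E" shows "closed e"
proof -
  have "e \<in> grid_sides a l m n \<or> e \<in> grid_pleats a l m n"
    using assms by (simp add: grid_creases_def)
  then show ?thesis
  proof
    assume "e \<in> grid_sides a l m n"
    then show ?thesis
      unfolding sides_eq by (auto simp: grid_side_segment)
  next
    assume "e \<in> grid_pleats a l m n"
    then obtain i j q b where e: "i < m" "j < n" "q < 4" "e = grid_pleat i j q b"
      unfolding pleats_eq by blast
    then show ?thesis
      using grid_pleat_segment[OF e(1-3), of b] by auto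
  qed
qed

lemma finite_vertices: "finite V"
  unfolding grid_vertices_def twist_corners_def by auto

lemma grid_vertex_in_interior:
  assumes "i < m" "j < n" "q < 4"
  shows "grid_vertex i j q \<in> interior X"
proof -
  have "place i j ` cbox (Complex (- l) (- l)) (Complex l l) \<subseteq> X"
    using assms unfolding grid_sheet_def by blast
  then have "place i j ` box (Complex (- l) (- l)) (Complex l l) \<subseteq> X"
    using box_subset_cbox by blast
  then have "place i j ` box (Complex (- l) (- l)) (Complex l l) \<subseteq> interior X"
    by (rule interior_maximal) (rule rigid_open[OF rigid_place_cell open_box])
  moreover have "corner a q \<in> box (Complex (- l) (- l)) (Complex l l)"
    using corner_interior[OF assms(3)] by (auto simp: in_box_complex_iff abs_less_iff)
  ultimately show ?thesis
    unfolding grid_vertex_def by blast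
qed

text \<open>
  The disk has to avoid finitely many closed sets that do not contain the vertex.
\<close>
lemma small_disk_exists:
  assumes "i < m" "j < n" "q < 4"
  shows "\<exists>r. small_disk X V E (grid_vertex i j q) r"
proof -
  define U where "U = interior X - (V - {grid_vertex i j q}) - \<Union>{e \<in> E. grid_vertex i j q \<notin> e}"
  have "closed (\<Union>{e \<in> E. grid_vertex i j q \<notin> e})"
    using finite_creases closed_crease by (intro closed_Union) auto
  moreover have "closed (V - {grid_vertex i j q})"
    using finite_vertices by (intro finite_imp_closed) simp
  ultimately have "open U"
    unfolding U_def by (intro open_Diff open_interior)
  moreover have "grid_vertex i j q \<in> U"
    using grid_vertex_in_interior[OF assms] unfolding U_def by blast
  ultimately obtain r where r: "0 < r" "cball (grid_vertex i j q) r \<subseteq> U"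
    by (auto simp: open_contains_cball)
  have "grid_vertex i j q \<in> cball (grid_vertex i j q) r" using r(1) by simp
  then have "small_disk X V E (grid_vertex i j q) r"
    using r grid_vertex_in_V[OF assms] unfolding small_disk_def U_def by blast
  then show ?thesis by blast
qed

text \<open>
  Every side is a side of the largest sector at its first corner and of the smallest sector at its
  second one, and its partners there are the two creases of the pleat that starts from it. So the
  conditions at the corners can be sorted by sides.
\<close>
lemma locally_folds_flat_grid_iff:
  assumes "\<mu> \<in> mv_assignments E"
  shows "locally_folds_flat X V E \<mu> \<longleftrightarrow>
    (\<forall>i<m. \<forall>j<n. \<forall>q<4. \<mu> (grid_pleat i j q False) = \<mu> (grid_side i j q) \<and>
       \<mu> (grid_pleat i j q True) = - \<mu> (grid_side i j q))" (is "_ \<longleftrightarrow> ?R")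
proof -
  define C where "C i j q \<longleftrightarrow> \<mu> (grid_pleat i j q False) = \<mu> (grid_side i j q) \<and>
    \<mu> (grid_side i j ((q + 3) mod 4)) = - \<mu> (grid_pleat i j ((q + 3) mod 4) True)" for i j q
  have "locally_folds_flat X V E \<mu> \<longleftrightarrow> (\<forall>i<m. \<forall>j<n. \<forall>q<4. C i j q)"
  proof
    assume flat: "locally_folds_flat X V E \<mu>"
    show "\<forall>i<m. \<forall>j<n. \<forall>q<4. C i j q"
    proof (intro allI impI)
      fix i j q :: nat assume ijq: "i < m" "j < n" "q < 4"
      then obtain r where "small_disk X V E (grid_vertex i j q) r" "disk_folds_flat E \<mu> (grid_vertex i j q) r"
        using flat grid_vertex_in_V unfolding locally_folds_flat_def by blast
      then show "C i j q"
        unfolding C_def using disk_folds_flat_grid_iff[OF ijq _ assms] by blast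
    qed
  next
    assume C: "\<forall>i<m. \<forall>j<n. \<forall>q<4. C i j q"
    show "locally_folds_flat X V E \<mu>"
      unfolding locally_folds_flat_def
    proof
      fix v assume "v \<in> V"
      then obtain i j q where ijq: "i < m" "j < n" "q < 4" "v = grid_vertex i j q"
        unfolding vertices_eq by blast
      obtain r where r: "small_disk X V E v r"
        using small_disk_exists[OF ijq(1-3)] unfolding ijq(4) by blast
      moreover have "disk_folds_flat E \<mu> v r"
        using disk_folds_flat_grid_iff[OF ijq(1-3) r[unfolded ijq(4)] assms] C ijq(1-3)
        unfolding C_def ijq(4) by blast
      ultimately show "\<exists>r. small_disk X V E v r \<and> disk_folds_flat E \<mu> v r"
        by blast
    qed
  qed
  moreover have "(\<forall>q<4. C i j q) \<longleftrightarrow> (\<forall>q<4. \<mu> (grid_pleat i j q False) = \<mu> (grid_side i j q) \<and>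
      \<mu> (grid_pleat i j q True) = - \<mu> (grid_side i j q))" for i j
  proof -
    have all4: "(\<forall>q<4. P q) \<longleftrightarrow> P 0 \<and> P 1 \<and> P 2 \<and> P 3" for P :: "nat \<Rightarrow> bool"
      by (metis less_4_cases one_less_numeral_iff semiring_norm(76) zero_less_numeral
          numeral_less_iff semiring_norm(77-81))
    show ?thesis
      unfolding all4 C_def by auto
  qed
  ultimately show ?thesis
    by simp
qed

end

section \<open>Counting\<close>

lemma card_image_same_fibers:
  assumes "\<And>x y. x \<in> A \<Longrightarrow> y \<in> A \<Longrightarrow> f x = f y \<longleftrightarrow> g x = g y"
  shows "card (f ` A) = card (g ` A)"
proof -
  have g_inv: "inv_into A g z \<in> A" "g (inv_into A g z) = z" if "z \<in> g ` A" for z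
    using that by (auto intro: inv_into_into f_inv_into_f)
  have "bij_betw (\<lambda>z. f (inv_into A g z)) (g ` A) (f ` A)"
    unfolding bij_betw_def
  proof
    show "inj_on (\<lambda>z. f (inv_into A g z)) (g ` A)"
    proof (rule inj_onI)
      fix y z assume "y \<in> g ` A" "z \<in> g ` A" "f (inv_into A g y) = f (inv_into A g z)"
      then show "y = z"
        using assms[of "inv_into A g y" "inv_into A g z"] g_inv[of y] g_inv[of z] by simp
    qed
    have "f (inv_into A g (g x)) = f x" if "x \<in> A" for x
      using assms[of "inv_into A g (g x)" x] g_inv[of "g x"] that by simp
    then show "(\<lambda>z. f (inv_into A g z)) ` g ` A = f ` A"
      by (auto simp: image_image cong: image_cong_simp)
  qed
  then show ?thesis
    by (metis bij_betw_same_card)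
qed

context twist_grid
begin

definition cells :: "(nat \<times> nat \<times> nat) set" where
  "cells = {..<m} \<times> {..<n} \<times> {..<4}"

text \<open>
  Pleats along a row are numbered by row and vertical grid line, pleats along a column by horizontal
  grid line and column. The direction need not be recorded, by \<open>seam_parity\<close>.
\<close>
definition gap :: "nat \<times> nat \<times> nat \<Rightarrow> nat \<times> nat + nat \<times> nat" where
  "gap = (\<lambda>(i, j, q). if even q then Inl (i, seam (q = 0) j) else Inr (seam (q = 1) i, j))"

text \<open>
  One crease of each pleat. Both ends of a pleat agree on which crease this is, because neighbouring
  cells are mirror images in the line between them.
\<close>
definition free_pleats :: "complex set set" where
  "free_pleats = (\<lambda>(i, j, q). grid_pleat i j q False) ` cells"

lemma gap_eq_iff:
  assumes "q < 4" "q' < 4"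
  shows "gap (i, j, q) = gap (i', j', q') \<longleftrightarrow> q = q' \<and> pleat_class i j q = pleat_class i' j' q"
proof
  assume eq: "gap (i, j, q) = gap (i', j', q')"
  have "even q \<longleftrightarrow> even q'"
    using eq by (auto simp: gap_def split: if_splits)
  moreover have "q = 0 \<longleftrightarrow> q' = 0" if "even q" "even q'"
  proof -
    have "seam (q = 0) j = seam (q' = 0) j'"
      using eq that by (simp add: gap_def)
    then show ?thesis
      using seam_parity[of "q = 0" j] seam_parity[of "q' = 0" j'] by metis
  qed
  moreover have "q = 1 \<longleftrightarrow> q' = 1" if "odd q" "odd q'"
  proof -
    have "seam (q = 1) i = seam (q' = 1) i'"
      using eq that by (simp add: gap_def)
    then show ?thesis
      using seam_parity[of "q = 1" i] seam_parity[of "q' = 1" i'] by metis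
  qed
  ultimately have "q = q'"
    using assms by (elim less_4_cases) simp_all
  then show "q = q' \<and> pleat_class i j q = pleat_class i' j' q"
    using eq by (cases "even q") (simp_all add: gap_def pleat_class_def)
next
  assume same: "q = q' \<and> pleat_class i j q = pleat_class i' j' q"
  then have q': "q' = q" by simp
  show "gap (i, j, q) = gap (i', j', q')"
    unfolding q' using conjunct2[OF same] by (cases "even q") (simp_all add: gap_def pleat_class_def)
qed

text \<open>
  A row of \<open>n\<close> cells has \<open>n + 1\<close> pleats, one across each vertical line, and a column of \<open>m\<close> cells
  has \<open>m + 1\<close>.
\<close>
lemma gap_image:
  assumes "1 \<le> m" "1 \<le> n"
  shows "gap ` cells = ({..<m} \<times> {..n}) <+> ({..m} \<times> {..<n})"
proof (intro equalityI subsetI)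
  fix z assume "z \<in> gap ` cells"
  then obtain i j q where "i < m" "j < n" "z = gap (i, j, q)"
    unfolding cells_def by auto
  then show "z \<in> ({..<m} \<times> {..n}) <+> ({..m} \<times> {..<n})"
    using seam_le[of j n] seam_le[of i m] by (auto simp: gap_def)
next
  fix z assume z: "z \<in> ({..<m} \<times> {..n}) <+> ({..m} \<times> {..<n})"
  show "z \<in> gap ` cells"
  proof (cases z)
    case (Inl p)
    obtain i k where p: "p = (i, k)" "i < m" "k \<le> n"
      using z Inl by (cases p) auto
    obtain j where j: "j < n" "seam (odd k) j = k"
      using seam_surj[OF assms(2) p(3)] by blast
    have "z = gap (i, j, if odd k then 0 else 2)"
      using j by (cases "odd k") (simp_all add: gap_def Inl p)
    moreover have "(i, j, if odd k then 0 else 2) \<in> cells"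
      using p j by (simp add: cells_def)
    ultimately show ?thesis by blast
  next
    case (Inr p)
    obtain k j where p: "p = (k, j)" "k \<le> m" "j < n"
      using z Inr by (cases p) auto
    obtain i where i: "i < m" "seam (odd k) i = k"
      using seam_surj[OF assms(1) p(2)] by blast
    have "z = gap (i, j, if odd k then 1 else 3)"
      using i by (cases "odd k") (simp_all add: gap_def Inr p)
    moreover have "(i, j, if odd k then 1 else 3) \<in> cells"
      using p i by (simp add: cells_def)
    ultimately show ?thesis by blast
  qed
qed

lemma card_free_pleats:
  assumes "1 \<le> m" "1 \<le> n"
  shows "card free_pleats = 2 * m * n + m + n"
proof -
  have "card free_pleats = card (gap ` cells)"
    unfolding free_pleats_def
  proof (rule card_image_same_fibers)
    fix x y assume "x \<in> cells" "y \<in> cells"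
    then obtain i j q i' j' q' where x: "x = (i, j, q)" "i < m" "j < n" "q < 4"
      and y: "y = (i', j', q')" "i' < m" "j' < n" "q' < 4"
      unfolding cells_def by auto
    show "(case x of (i, j, q) \<Rightarrow> grid_pleat i j q False) = (case y of (i, j, q) \<Rightarrow> grid_pleat i j q False) \<longleftrightarrow>
        gap x = gap y"
      unfolding x(1) y(1) gap_eq_iff[OF x(4) y(4)] using grid_pleat_eq_iff[OF x(2-4) y(2-4)] by simp
  qed
  also have "\<dots> = m * (n + 1) + (m + 1) * n"
    unfolding gap_image[OF assms] by (simp add: card_Plus)
  finally show ?thesis
    by (simp add: algebra_simps)
qed

definition coherent :: "(complex set \<Rightarrow> int) set" where
  "coherent = {\<mu> \<in> mv_assignments E. \<forall>i<m. \<forall>j<n. \<forall>q<4.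
     \<mu> (grid_pleat i j q False) = \<mu> (grid_side i j q) \<and> \<mu> (grid_pleat i j q True) = - \<mu> (grid_side i j q)}"

lemma crease_cases:
  assumes "e \<in> E"
  obtains i j q where "i < m" "j < n" "q < 4"
    "e = grid_pleat i j q False \<or> e = grid_side i j q \<or> e = grid_pleat i j q True"
proof -
  have "e \<in> grid_sides a l m n \<or> e \<in> grid_pleats a l m n"
    using assms by (simp add: grid_creases_def)
  then show ?thesis
  proof
    assume "e \<in> grid_sides a l m n"
    then show ?thesis
      unfolding sides_eq using that by blast
  next
    assume "e \<in> grid_pleats a l m n"
    then obtain i j q b where "i < m" "j < n" "q < 4" "e = grid_pleat i j q b"
      unfolding pleats_eq by blast
    then show ?thesis
      using that[of i j q] by (cases b) simp_all
  qed
qed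

lemma creases_in_E:
  "i < m \<Longrightarrow> j < n \<Longrightarrow> q < 4 \<Longrightarrow> grid_pleat i j q b \<in> E"
  "i < m \<Longrightarrow> j < n \<Longrightarrow> q < 4 \<Longrightarrow> grid_side i j q \<in> E"
  unfolding grid_creases_def pleats_eq sides_eq by blast+

lemma mem_free_pleats: "h \<in> free_pleats \<longleftrightarrow> (\<exists>i<m. \<exists>j<n. \<exists>q<4. h = grid_pleat i j q False)"
  unfolding free_pleats_def cells_def by (auto simp: image_iff)

lemma coherent_determined:
  assumes "\<mu> \<in> coherent" "\<nu> \<in> coherent" "\<And>h. h \<in> free_pleats \<Longrightarrow> \<mu> h = \<nu> h"
  shows "\<mu> = \<nu>"
proof (rule PiE_ext)
  show "\<mu> \<in> E \<rightarrow>\<^sub>E {- 1, 1}" "\<nu> \<in> E \<rightarrow>\<^sub>E {- 1, 1}"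
    using assms(1,2) by (simp_all add: coherent_def mv_assignments_def)
  fix e assume "e \<in> E"
  then obtain i j q where ijq: "i < m" "j < n" "q < 4"
    and e: "e = grid_pleat i j q False \<or> e = grid_side i j q \<or> e = grid_pleat i j q True"
    by (rule crease_cases)
  have "\<mu> (grid_pleat i j q False) = \<nu> (grid_pleat i j q False)"
    using assms(3) ijq mem_free_pleats by blast
  moreover have "\<mu> (grid_pleat i j q False) = \<mu> (grid_side i j q)" "\<mu> (grid_pleat i j q True) = - \<mu> (grid_side i j q)"
    "\<nu> (grid_pleat i j q False) = \<nu> (grid_side i j q)" "\<nu> (grid_pleat i j q True) = - \<nu> (grid_side i j q)"
    using assms(1,2) ijq by (simp_all add: coherent_def)
  ultimately show "\<mu> e = \<nu> e"
    using e by (elim disjE) simp_all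
qed

text \<open>
  The value at a crease is copied or negated from the free crease of its pleat. This is well defined
  since a side belongs to one pleat and both creases of a pleat have the same class.
\<close>
lemma coherent_extension:
  assumes g: "g \<in> free_pleats \<rightarrow>\<^sub>E {- 1, 1 :: int}"
  shows "\<exists>\<mu>\<in>coherent. \<forall>h\<in>free_pleats. \<mu> h = g h"
proof -
  define P where "P e x \<longleftrightarrow> (\<exists>i j q. i < m \<and> j < n \<and> q < 4 \<and>
      ((e = grid_pleat i j q False \<or> e = grid_side i j q) \<and> x = g (grid_pleat i j q False) \<or>
       e = grid_pleat i j q True \<and> x = - g (grid_pleat i j q False)))" for e x
  \<comment> \<open>\<open>P e x\<close> has exactly one solution \<open>x\<close> for every crease \<open>e\<close>\<close>
  define \<mu> where "\<mu> = (\<lambda>e\<in>E. SOME x. P e x)"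
  have val: "\<mu> e = x" if "e \<in> E" "P e x" "\<And>y. P e y \<Longrightarrow> y = x" for e x
    using someI[of "P e", OF that(2)] that(1,3) by (simp add: \<mu>_def)
  have pleat_False: "\<mu> (grid_pleat i j q False) = g (grid_pleat i j q False)"
    if ijq: "i < m" "j < n" "q < 4" for i j q
  proof (rule val)
    show "grid_pleat i j q False \<in> E" by (rule creases_in_E(1)[OF ijq])
    show "P (grid_pleat i j q False) (g (grid_pleat i j q False))"
      unfolding P_def using ijq by blast
    fix y assume "P (grid_pleat i j q False) y"
    then obtain i' j' q' where ijq': "i' < m" "j' < n" "q' < 4"
      and y: "(grid_pleat i j q False = grid_pleat i' j' q' False \<or> grid_pleat i j q False = grid_side i' j' q') \<and>
          y = g (grid_pleat i' j' q' False) \<or> grid_pleat i j q False = grid_pleat i' j' q' True \<and> y = - g (grid_pleat i' j' q' False)"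
      unfolding P_def by blast
    have "grid_pleat i j q False \<noteq> grid_side i' j' q'" "grid_pleat i j q False \<noteq> grid_pleat i' j' q' True"
      using grid_side_neq_grid_pleat[OF ijq' ijq(3), of i j False] grid_pleat_eq_iff[OF ijq ijq', of False True]
      by (metis, blast)
    then show "y = g (grid_pleat i j q False)"
      using y by metis
  qed
  have side: "\<mu> (grid_side i j q) = g (grid_pleat i j q False)" if ijq: "i < m" "j < n" "q < 4" for i j q
  proof (rule val)
    show "grid_side i j q \<in> E" by (rule creases_in_E(2)[OF ijq])
    show "P (grid_side i j q) (g (grid_pleat i j q False))"
      unfolding P_def using ijq by blast
    fix y assume "P (grid_side i j q) y"
    then obtain i' j' q' where ijq': "i' < m" "j' < n" "q' < 4"
      and y: "(grid_side i j q = grid_pleat i' j' q' False \<or> grid_side i j q = grid_side i' j' q') \<and>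
          y = g (grid_pleat i' j' q' False) \<or> grid_side i j q = grid_pleat i' j' q' True \<and> y = - g (grid_pleat i' j' q' False)"
      unfolding P_def by blast
    have "grid_side i j q = grid_side i' j' q' \<and> y = g (grid_pleat i' j' q' False)"
      using y grid_side_neq_grid_pleat[OF ijq ijq'(3)] by blast
    then show "y = g (grid_pleat i j q False)"
      using grid_side_eq_iff[OF ijq(3) ijq'(3), of i j i' j'] by simp
  qed
  have pleat_True: "\<mu> (grid_pleat i j q True) = - g (grid_pleat i j q False)"
    if ijq: "i < m" "j < n" "q < 4" for i j q
  proof (rule val)
    show "grid_pleat i j q True \<in> E" by (rule creases_in_E(1)[OF ijq])
    show "P (grid_pleat i j q True) (- g (grid_pleat i j q False))"
      unfolding P_def using ijq by blast
    fix y assume "P (grid_pleat i j q True) y"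
    then obtain i' j' q' where ijq': "i' < m" "j' < n" "q' < 4"
      and y: "(grid_pleat i j q True = grid_pleat i' j' q' False \<or> grid_pleat i j q True = grid_side i' j' q') \<and>
          y = g (grid_pleat i' j' q' False) \<or> grid_pleat i j q True = grid_pleat i' j' q' True \<and> y = - g (grid_pleat i' j' q' False)"
      unfolding P_def by blast
    have "grid_pleat i j q True \<noteq> grid_side i' j' q'" "grid_pleat i j q True \<noteq> grid_pleat i' j' q' False"
      using grid_side_neq_grid_pleat[OF ijq' ijq(3), of i j True] grid_pleat_eq_iff[OF ijq ijq', of True False]
      by (metis, blast)
    then have y': "grid_pleat i j q True = grid_pleat i' j' q' True" "y = - g (grid_pleat i' j' q' False)"
      using y by blast+
    have "grid_pleat i j q False = grid_pleat i' j' q' False"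
      using y'(1) unfolding grid_pleat_eq_iff[OF ijq ijq'] by blast
    then show "y = - g (grid_pleat i j q False)"
      using y'(2) by simp
  qed
  have g_vals: "g (grid_pleat i j q False) \<in> {- 1, 1}" if "i < m" "j < n" "q < 4" for i j q
    using g mem_free_pleats that by (intro PiE_mem[OF g]) blast
  have "\<mu> e \<in> {- 1, 1}" if "e \<in> E" for e
    using that
  proof (rule crease_cases)
    fix i j q assume ijq: "i < m" "j < n" "q < 4"
      and e: "e = grid_pleat i j q False \<or> e = grid_side i j q \<or> e = grid_pleat i j q True"
    show "\<mu> e \<in> {- 1, 1}"
      using e pleat_False[OF ijq] side[OF ijq] pleat_True[OF ijq] g_vals[OF ijq] by auto
  qed
  then have "\<mu> \<in> mv_assignments E"
    unfolding mv_assignments_def by (intro PiE_I) (simp_all add: \<mu>_def)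
  then have "\<mu> \<in> coherent"
    unfolding coherent_def using pleat_False side pleat_True by simp
  moreover have "\<mu> h = g h" if "h \<in> free_pleats" for h
    using that pleat_False unfolding mem_free_pleats by blast
  ultimately show ?thesis by blast
qed

lemma finite_free_pleats: "finite free_pleats"
  by (simp add: free_pleats_def cells_def)

lemma card_coherent: "card coherent = 2 ^ card free_pleats"
proof -
  have "bij_betw (\<lambda>\<mu>. restrict \<mu> free_pleats) coherent (free_pleats \<rightarrow>\<^sub>E {- 1, 1 :: int})"
    unfolding bij_betw_def
  proof
    show "inj_on (\<lambda>\<mu>. restrict \<mu> free_pleats) coherent"
    proof (rule inj_onI)
      fix \<mu> \<nu> assume *: "\<mu> \<in> coherent" "\<nu> \<in> coherent" "restrict \<mu> free_pleats = restrict \<nu> free_pleats"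
      show "\<mu> = \<nu>"
        by (rule coherent_determined[OF *(1,2)]) (metis *(3) restrict_apply')
    qed
    show "(\<lambda>\<mu>. restrict \<mu> free_pleats) ` coherent = free_pleats \<rightarrow>\<^sub>E {- 1, 1 :: int}"
    proof (intro equalityI subsetI)
      fix g assume "g \<in> (\<lambda>\<mu>. restrict \<mu> free_pleats) ` coherent"
      then obtain \<mu> where \<mu>: "\<mu> \<in> coherent" "g = restrict \<mu> free_pleats" by blast
      have "\<mu> h \<in> {- 1, 1}" if "h \<in> free_pleats" for h
      proof -
        have "h \<in> E" using that creases_in_E(1) unfolding mem_free_pleats by blast
        moreover have "\<mu> \<in> E \<rightarrow>\<^sub>E {- 1, 1}"
          using \<mu>(1) by (simp add: coherent_def mv_assignments_def)
        ultimately show ?thesis by (rule PiE_mem[rotated])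
      qed
      then show "g \<in> free_pleats \<rightarrow>\<^sub>E {- 1, 1}"
        unfolding \<mu>(2) by (simp add: restrict_PiE_iff)
    next
      fix g assume g: "g \<in> free_pleats \<rightarrow>\<^sub>E {- 1, 1 :: int}"
      then obtain \<mu> where \<mu>: "\<mu> \<in> coherent" "\<forall>h\<in>free_pleats. \<mu> h = g h"
        using coherent_extension by blast
      have "g = restrict \<mu> free_pleats"
        by (rule PiE_ext[OF g]) (use \<mu>(2) g in \<open>auto simp: restrict_PiE_iff\<close>)
      then show "g \<in> (\<lambda>\<mu>. restrict \<mu> free_pleats) ` coherent"
        using \<mu>(1) by blast
    qed
  qed
  then have "card coherent = card (free_pleats \<rightarrow>\<^sub>E {- 1, 1 :: int})"
    by (rule bij_betw_same_card)
  also have "\<dots> = 2 ^ card free_pleats"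
    using finite_free_pleats by (simp add: card_funcsetE numeral_2_eq_2)
  finally show ?thesis .
qed

end

theorem theorem3p5:
  fixes a l :: real and m n :: nat
  assumes "0 < a" and "a < l" and "1 \<le> m" and "1 \<le> n"
  shows "card {\<mu> \<in> mv_assignments (grid_creases a l m n).
                 locally_folds_flat (grid_sheet l m n) (grid_vertices a l m n)
                   (grid_creases a l m n) \<mu>} = 2 ^ (2 * m * n + m + n)"
proof -
  interpret twist_grid a l m n
    by unfold_locales (fact assms)+
  have "{\<mu> \<in> mv_assignments E. locally_folds_flat X V E \<mu>} = coherent"
    unfolding coherent_def by (rule Collect_cong) (metis locally_folds_flat_grid_iff)
  then show ?thesis
    by (simp only: card_coherent card_free_pleats[OF assms(3,4)])
qed

end
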